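(* Let $M$ be a matroid on a finite ground set $E$ and $<$ a linear order on $E$. The reduced external activity complex $\mathrm{Act}^\bullet_<(M)$ is contractible if $M$ contains $U_{3,1}$ as a minor, and is homeomorphic to a sphere otherwise.
   Context: For a basis $B$ and $e\in E-B$, $\mathrm{Circ}(B,e)$ is the unique circuit in $B\cup e$; $EA(B)=\{e\in E-B: e=\min_<\mathrm{Circ}(B,e)\}$, $EP(B)=(E-B)-EA(B)$. With $\overline{E}$ a disjoint copy of $E$ and $\overline{S}$ the copy of $S\subseteq E$, the external activity complex $\mathrm{Act}_<(M)$ is the simplicial complex on $E\sqcup\overline{E}$ with facets $F(B)=B\cup EP(B)\cup\overline{B\cup EA(B)}$, $B$ a basis. A cone point is an element contained in every facet. $\mathrm{Act}^\bullet_<(M)$ is obtained from $\mathrm{Act}_<(M)$ by deleting all cone points (its facets are the sets $F(B)$ minus the cone points). $U_{3,1}$ is the uniform matroid on $\{1,2,3\}$ of rank $1$ (independent sets: all subsets of size at most $1$). A minor of $M$ is a matroid isomorphic to one obtained from $M$ by a sequence of deletions and contractions. *)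

theory Defs
  imports "HOL-Analysis.Analysis"
begin

section \<open>Matroids\<close>

record 'a indep_system =
  ground :: "'a set"
  indeps :: "'a set set"

locale matroid =
  fixes M :: "'a indep_system"
  assumes finite_ground: "finite (ground M)"
    and indeps_subset_ground: "I \<in> indeps M \<Longrightarrow> I \<subseteq> ground M"
    and empty_indep: "{} \<in> indeps M"
    and indep_subset: "J \<in> indeps M \<Longrightarrow> I \<subseteq> J \<Longrightarrow> I \<in> indeps M"
    and augment: "I \<in> indeps M \<Longrightarrow> J \<in> indeps M \<Longrightarrow> card I < card J
                    \<Longrightarrow> \<exists>x\<in>J - I. insert x I \<in> indeps M"

definition is_basis :: "'a indep_system \<Rightarrow> 'a set \<Rightarrow> bool" where
  "is_basis M B \<longleftrightarrow> B \<in> indeps M \<and> (\<forall>I\<in>indeps M. B \<subseteq> I \<longrightarrow> I = B)"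

definition is_circuit :: "'a indep_system \<Rightarrow> 'a set \<Rightarrow> bool" where
  "is_circuit M C \<longleftrightarrow> C \<subseteq> ground M \<and> C \<notin> indeps M \<and> (\<forall>D. D \<subset> C \<longrightarrow> D \<in> indeps M)"

definition uniform_matroid :: "'a set \<Rightarrow> nat \<Rightarrow> 'a indep_system" where
  "uniform_matroid E k = \<lparr>ground = E, indeps = {I. I \<subseteq> E \<and> card I \<le> k}\<rparr>"

definition U31 :: "nat indep_system" where
  "U31 = uniform_matroid {1, 2, 3} 1"


section \<open>Minors\<close>

definition matroid_delete :: "'a indep_system \<Rightarrow> 'a \<Rightarrow> 'a indep_system" where
  "matroid_delete M e = \<lparr>ground = ground M - {e}, indeps = {I \<in> indeps M. e \<notin> I}\<rparr>"

text \<open>Contracting a loop is, by convention, the same as deleting it.\<close>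

definition matroid_contract :: "'a indep_system \<Rightarrow> 'a \<Rightarrow> 'a indep_system" where
  "matroid_contract M e =
     (if {e} \<in> indeps M
      then \<lparr>ground = ground M - {e}, indeps = {I. e \<notin> I \<and> insert e I \<in> indeps M}\<rparr>
      else matroid_delete M e)"

inductive reduces_to :: "'a indep_system \<Rightarrow> 'a indep_system \<Rightarrow> bool" for M where
  refl: "reduces_to M M"
| delete: "reduces_to M N \<Longrightarrow> e \<in> ground N \<Longrightarrow> reduces_to M (matroid_delete N e)"
| contract: "reduces_to M N \<Longrightarrow> e \<in> ground N \<Longrightarrow> reduces_to M (matroid_contract N e)"

definition matroid_iso :: "'a indep_system \<Rightarrow> 'b indep_system \<Rightarrow> bool" where
  "matroid_iso M N \<longleftrightarrow>
     (\<exists>f. bij_betw f (ground M) (ground N) \<and>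
          (\<forall>X\<subseteq>ground M. X \<in> indeps M \<longleftrightarrow> f ` X \<in> indeps N))"

definition has_minor :: "'a indep_system \<Rightarrow> 'b indep_system \<Rightarrow> bool" where
  "has_minor M N \<longleftrightarrow> (\<exists>N'. reduces_to M N' \<and> matroid_iso N' N)"


section \<open>Abstract simplicial complexes\<close>

text \<open>A complex is given by its set of faces; the empty set is a face.\<close>

definition facets :: "'v set set \<Rightarrow> 'v set set" where
  "facets K = {F \<in> K. \<forall>G\<in>K. F \<subseteq> G \<longrightarrow> G = F}"

definition cone_points :: "'v set set \<Rightarrow> 'v set" where
  "cone_points K = {v. \<forall>F\<in>facets K. v \<in> F}"

definition delete_vertices :: "'v set set \<Rightarrow> 'v set \<Rightarrow> 'v set set" where
  "delete_vertices K V = {F \<in> K. F \<inter> V = {}}"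

text \<open>
  Points are given by their barycentric coordinates. The product topology on the coordinates
  gives the usual geometric realization when there are only finitely many vertices.
  The complex whose only face is the empty set has empty realization.
\<close>

definition realization :: "'v set set \<Rightarrow> ('v \<Rightarrow> real) topology" where
  "realization K = subtopology (powertop_real UNIV)
     {x. (\<forall>v. 0 \<le> x v) \<and> {v. x v \<noteq> 0} \<in> K \<and> (\<Sum>v | x v \<noteq> 0. x v) = 1}"


section \<open>The external activity complex\<close>

text \<open>
  The linear order on the ground set is a reflexive relation \<open>r\<close>, with \<open>(x, y) \<in> r\<close> for
  \<open>x \<le> y\<close>.
\<close>

definition fund_circuit :: "'a indep_system \<Rightarrow> 'a set \<Rightarrow> 'a \<Rightarrow> 'a set" where
  "fund_circuit M B e = (THE C. is_circuit M C \<and> C \<subseteq> insert e B)"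

definition ext_active :: "'a indep_system \<Rightarrow> 'a rel \<Rightarrow> 'a set \<Rightarrow> 'a set" where
  "ext_active M r B =
     {e \<in> ground M - B. e \<in> fund_circuit M B e \<and> (\<forall>x\<in>fund_circuit M B e. (e, x) \<in> r)}"

definition ext_passive :: "'a indep_system \<Rightarrow> 'a rel \<Rightarrow> 'a set \<Rightarrow> 'a set" where
  "ext_passive M r B = (ground M - B) - ext_active M r B"

text \<open>The disjoint union of the ground set and its copy lives in a sum type, \<open>Inr\<close> giving the
  copy.\<close>

definition act_facet :: "'a indep_system \<Rightarrow> 'a rel \<Rightarrow> 'a set \<Rightarrow> ('a + 'a) set" where
  "act_facet M r B = Inl ` (B \<union> ext_passive M r B) \<union> Inr ` (B \<union> ext_active M r B)"

definition Act :: "'a indep_system \<Rightarrow> 'a rel \<Rightarrow> ('a + 'a) set set" where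
  "Act M r = {F. \<exists>B. is_basis M B \<and> F \<subseteq> act_facet M r B}"

definition reduced_Act :: "'a indep_system \<Rightarrow> 'a rel \<Rightarrow> ('a + 'a) set set" where
  "reduced_Act M r = delete_vertices (Act M r) (cone_points (Act M r))"


section \<open>Spheres\<close>

text \<open>
  In the library, \<^const>\<open>nsphere\<close> \<open>n\<close> is the unit sphere of dimension \<open>n \<ge> 0\<close>. The empty space
  is the sphere of dimension \<open>-1\<close>; it arises as the realization of the complex with only the
  empty face, for instance if the matroid has a single basis.
\<close>

definition homeomorphic_to_sphere :: "'a topology \<Rightarrow> bool" where
  "homeomorphic_to_sphere X \<longleftrightarrow> topspace X = {} \<or> (\<exists>n. X homeomorphic_space nsphere n)"

end

(* The minimal nonfaces of the external activity complex are the sets consisting of Inl c for the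
   minimum c of a circuit C and of Inr x for all other elements x of C. The vertices on no minimal
   nonface are exactly the cone points.

   Without a U31 minor any two circuits are disjoint, so the reduced complex is the join of the
   boundaries of disjoint simplices; subtracting a base coordinate in every block and normalizing
   maps it onto a Euclidean sphere.

   With a U31 minor two distinct circuits intersect, and then some element e is the minimum of one
   circuit and a non-minimal element of another. The faces containing the nonface of a circuit with
   non-minimal element e, except possibly for Inr e, can be pushed away towards Inl e, and what is
   left is a cone with apex Inr e. *)

theory Submission
  imports Defs
begin

section \<open>Circuits of a matroid\<close>

text \<open>After the cone points are gone, \<open>Inl e\<close> and \<open>Inr e\<close> are both
  vertices exactly when \<open>e\<close> is the minimum of one circuit and a non-minimal element of
  another. This configuration separates the two cases: one of the two vertices serves as the apex
  for the removals, the other as the apex of what remains. Several nonfaces have to be removed, and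
  the removals do not interfere because none of these sets contains \<open>Inl e\<close>. The empty
  space counts as contractible, so nonemptiness is proved along with contractibility. In the other
  case the dimension of the sphere is the sum of \<open>card C - 1\<close> over all circuits
  \<open>C\<close>, minus one; if every circuit is a loop, or there is none, this is -1 and the
  realization is empty.\<close>

context matroid
begin

lemma indep_finite: "I \<in> indeps M \<Longrightarrow> finite I"
  using finite_ground finite_subset indeps_subset_ground by blast

lemma extend_to_maximal:
  assumes "I \<in> indeps M" "I \<subseteq> S"
  obtains J where "I \<subseteq> J" "J \<subseteq> S" "J \<in> indeps M"
    "\<And>x. x \<in> S \<Longrightarrow> x \<notin> J \<Longrightarrow> insert x J \<notin> indeps M"
proof -
  let ?A = "{J \<in> indeps M. I \<subseteq> J \<and> J \<subseteq> S}"
  have "finite ?A"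
    by (rule finite_subset[of _ "Pow (ground M)"]) (use indeps_subset_ground finite_ground in auto)
  moreover have "?A \<noteq> {}" using assms by auto
  ultimately obtain J where J: "J \<in> ?A" and max: "\<And>K. K \<in> ?A \<Longrightarrow> J \<subseteq> K \<Longrightarrow> J = K"
    using finite_has_maximal[of ?A] by meson
  have "insert x J \<notin> indeps M" if "x \<in> S" "x \<notin> J" for x
    using max[of "insert x J"] J that by blast
  with J show thesis by (intro that[of J]) auto
qed

lemma maximal_card:
  assumes "J \<in> indeps M" "\<And>x. x \<in> S \<Longrightarrow> x \<notin> J \<Longrightarrow> insert x J \<notin> indeps M"
    and "I \<in> indeps M" "I \<subseteq> S"
  shows "card I \<le> card J"
  using augment[of J I] assms by (meson DiffD1 DiffD2 not_le subsetD)

lemma circuit_subset_ground: "is_circuit M C \<Longrightarrow> C \<subseteq> ground M"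
  by (simp add: is_circuit_def)

lemma circuit_dependent: "is_circuit M C \<Longrightarrow> C \<notin> indeps M"
  by (simp add: is_circuit_def)

lemma finite_circuit: "is_circuit M C \<Longrightarrow> finite C"
  using circuit_subset_ground finite_ground finite_subset by blast

lemma circuit_nonempty: "is_circuit M C \<Longrightarrow> C \<noteq> {}"
  using empty_indep circuit_dependent by blast

lemma circuit_not_subset_indep: "is_circuit M C \<Longrightarrow> I \<in> indeps M \<Longrightarrow> \<not> C \<subseteq> I"
  using indep_subset circuit_dependent by blast

lemma circuit_psubset_indep: "is_circuit M C \<Longrightarrow> D \<subset> C \<Longrightarrow> D \<in> indeps M"
  by (simp add: is_circuit_def)

lemma circuit_remove_indep: "is_circuit M C \<Longrightarrow> e \<in> C \<Longrightarrow> C - {e} \<in> indeps M"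
  by (rule circuit_psubset_indep) auto

lemma circuit_subset_eq: "is_circuit M C \<Longrightarrow> is_circuit M D \<Longrightarrow> C \<subseteq> D \<Longrightarrow> C = D"
  using circuit_psubset_indep circuit_dependent by blast

lemma circuits_finite: "finite {C. is_circuit M C}"
  by (rule finite_subset[of _ "Pow (ground M)"]) (use circuit_subset_ground finite_ground in auto)

lemma dependent_contains_circuit:
  assumes "S \<subseteq> ground M" "S \<notin> indeps M"
  obtains C where "is_circuit M C" "C \<subseteq> S"
proof -
  let ?A = "{D. D \<subseteq> S \<and> D \<notin> indeps M}"
  have "finite ?A"
    by (rule finite_subset[of _ "Pow (ground M)"]) (use assms(1) finite_ground in auto)
  moreover have "?A \<noteq> {}" using assms by auto
  ultimately obtain C where C: "C \<in> ?A" and min: "\<And>D. D \<in> ?A \<Longrightarrow> D \<subseteq> C \<Longrightarrow> C = D"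
    using finite_has_minimal[of ?A] by meson
  have "is_circuit M C" unfolding is_circuit_def using C min assms(1) by blast
  with C that show thesis by auto
qed

lemma circuit_in_insert:
  assumes "I \<in> indeps M" "e \<in> ground M" "insert e I \<notin> indeps M"
  obtains C where "is_circuit M C" "C \<subseteq> insert e I" "e \<in> C"
proof -
  obtain C where C: "is_circuit M C" "C \<subseteq> insert e I"
    using dependent_contains_circuit[of "insert e I"] assms indeps_subset_ground by blast
  have "e \<in> C" using C circuit_not_subset_indep[OF C(1) assms(1)] by blast
  with C that show thesis by blast
qed

text \<open>In terms of closures: \<open>e\<close> lies in the closure of \<open>C2 - {e}\<close>, so a maximal
  independent subset \<open>I\<close> of \<open>C1 \<union> C2 - {e, f}\<close> still spans \<open>C1 - {f}\<close>, hence \<open>f\<close>.\<close>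

lemma strong_circuit_elimination:
  assumes C1: "is_circuit M C1" and C2: "is_circuit M C2"
    and e: "e \<in> C1" "e \<in> C2" and f: "f \<in> C1" "f \<notin> C2"
  obtains C where "is_circuit M C" "f \<in> C" "C \<subseteq> C1 \<union> C2 - {e}"
proof -
  let ?X = "C1 \<union> C2 - {e, f}"
  obtain I where I: "C2 - {e} \<subseteq> I" "I \<subseteq> ?X" "I \<in> indeps M"
    and Imax: "\<And>x. x \<in> ?X \<Longrightarrow> x \<notin> I \<Longrightarrow> insert x I \<notin> indeps M"
    using extend_to_maximal[OF circuit_remove_indep[OF C2 e(2)], of ?X] f by blast
  have "insert e I \<notin> indeps M"
    using circuit_not_subset_indep[OF C2, of "insert e I"] I(1) by blast
  with Imax have Imax': "\<And>x. x \<in> insert e ?X \<Longrightarrow> x \<notin> I \<Longrightarrow> insert x I \<notin> indeps M" by blast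
  have "insert f I \<notin> indeps M"
  proof
    assume indep: "insert f I \<in> indeps M"
    obtain J where J: "C1 - {f} \<subseteq> J" "J \<subseteq> insert e ?X" "J \<in> indeps M"
      and Jmax: "\<And>x. x \<in> insert e ?X \<Longrightarrow> x \<notin> J \<Longrightarrow> insert x J \<notin> indeps M"
      using extend_to_maximal[OF circuit_remove_indep[OF C1 f(1)], of "insert e ?X"] by blast
    have fJ: "insert f J \<notin> indeps M"
      using circuit_not_subset_indep[OF C1, of "insert f J"] J(1) by blast
    have "card J \<le> card I" using maximal_card[OF I(3) Imax' J(3) J(2)] .
    moreover have "card (insert f I) = Suc (card I)"
      using I indep_finite by (subst card_insert_disjoint) auto
    ultimately obtain x where x: "x \<in> insert f I - J" "insert x J \<in> indeps M"
      using augment[OF J(3) indep] by auto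
    then show False using fJ Jmax[of x] I(2) by auto
  qed
  then obtain C where C: "is_circuit M C" "C \<subseteq> insert f I" "f \<in> C"
    using circuit_in_insert[of I f] I(3) f(1) circuit_subset_ground[OF C1] by blast
  have "e \<noteq> f" using e f by blast
  with C I(2) f(1) that[of C] show thesis by blast
qed

lemma circuit_elimination:
  assumes "is_circuit M C1" "is_circuit M C2" "C1 \<noteq> C2" "e \<in> C1" "e \<in> C2"
  obtains C where "is_circuit M C" "C \<subseteq> C1 \<union> C2 - {e}"
proof -
  obtain f where "f \<in> C1" "f \<notin> C2" using circuit_subset_eq[OF assms(1,2)] assms(3) by blast
  then show thesis using strong_circuit_elimination[OF assms(1,2,4,5)] that by blast
qed

section \<open>Fundamental circuits and greedy bases\<close>

lemma fund_circuit_unique: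
  assumes "I \<in> indeps M" "is_circuit M C" "is_circuit M D" "C \<subseteq> insert e I" "D \<subseteq> insert e I"
  shows "C = D"
proof (rule ccontr)
  assume "C \<noteq> D"
  moreover have "e \<in> C" "e \<in> D"
    using assms circuit_not_subset_indep by (metis subset_insert)+
  ultimately obtain A where "is_circuit M A" "A \<subseteq> C \<union> D - {e}"
    using circuit_elimination[OF assms(2,3)] by blast
  then show False using circuit_not_subset_indep[OF _ assms(1), of A] assms(4,5) by blast
qed

lemma fund_circuit_eq:
  assumes "I \<in> indeps M" "is_circuit M C" "C \<subseteq> insert e I"
  shows "fund_circuit M I e = C"
  unfolding fund_circuit_def
proof (rule the_equality)
  show "D = C" if "is_circuit M D \<and> D \<subseteq> insert e I" for D
    using fund_circuit_unique[OF assms(1) _ assms(2) _ assms(3)] that by blast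
qed (use assms in blast)

lemma basis_circuit:
  assumes "is_basis M B" "e \<in> ground M" "e \<notin> B"
  obtains C where "is_circuit M C" "C \<subseteq> insert e B" "e \<in> C" "fund_circuit M B e = C"
proof -
  have B: "B \<in> indeps M" "insert e B \<notin> indeps M" using assms by (auto simp: is_basis_def)
  then obtain C where C: "is_circuit M C" "C \<subseteq> insert e B" "e \<in> C"
    using circuit_in_insert assms(2) by blast
  with that show thesis using fund_circuit_eq[OF B(1) C(1,2)] by blast
qed

text \<open>This is the greedy algorithm by increasing \<open>key\<close>. The induction adds an
  element of largest key last, so when \<open>x\<close> is rejected, the circuit that it closes
  consists of \<open>x\<close> and elements of no larger key. Later elements enlarge
  \<open>B\<close> but leave this circuit valid.\<close>

lemma greedy_basis:
  fixes key :: "'a \<Rightarrow> int"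
  obtains B where "is_basis M B"
    "\<And>x. x \<in> ground M \<Longrightarrow> x \<notin> B \<Longrightarrow>
      \<exists>C. is_circuit M C \<and> x \<in> C \<and> C \<subseteq> insert x B \<and> (\<forall>z\<in>C. key z \<le> key x)"
proof -
  have "S \<subseteq> ground M \<Longrightarrow> \<exists>B. B \<subseteq> S \<and> B \<in> indeps M \<and> (\<forall>x\<in>S - B.
      \<exists>C. is_circuit M C \<and> x \<in> C \<and> C \<subseteq> insert x B \<and> (\<forall>z\<in>C. key z \<le> key x))"
    if "finite S" for S
    using that
  proof (induction S rule: finite_ranking_induct[where f = key])
    case empty
    then show ?case using empty_indep by auto
  next
    case (insert x S)
    then obtain B where B: "B \<subseteq> S" "B \<in> indeps M" "\<forall>x\<in>S - B.
      \<exists>C. is_circuit M C \<and> x \<in> C \<and> C \<subseteq> insert x B \<and> (\<forall>z\<in>C. key z \<le> key x)" by blast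
    show ?case
    proof (cases "insert x B \<in> indeps M")
      case True
      have "\<exists>C. is_circuit M C \<and> y \<in> C \<and> C \<subseteq> insert y (insert x B) \<and> (\<forall>z\<in>C. key z \<le> key y)"
        if "y \<in> insert x S - insert x B" for y
        using B(3) that by (metis Diff_iff insert_iff insert_commute subset_insertI2)
      with True B(1) show ?thesis by (intro exI[of _ "insert x B"]) auto
    next
      case False
      obtain C where C: "is_circuit M C" "C \<subseteq> insert x B" "x \<in> C"
        using circuit_in_insert[OF B(2) _ False] insert.prems by blast
      then have "\<forall>z\<in>C. key z \<le> key x" using insert.hyps(2) B(1) by auto
      with C B show ?thesis by (intro exI[of _ B]) auto
    qed
  qed
  from this[OF finite_ground] obtain B where B: "B \<subseteq> ground M" "B \<in> indeps M"
    "\<forall>x\<in>ground M - B. \<exists>C. is_circuit M C \<and> x \<in> C \<and> C \<subseteq> insert x B \<and> (\<forall>z\<in>C. key z \<le> key x)"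
    by auto
  have "is_basis M B"
    unfolding is_basis_def
  proof (intro conjI ballI impI)
    fix I assume I: "I \<in> indeps M" "B \<subseteq> I"
    show "I = B"
    proof (rule ccontr)
      assume "I \<noteq> B"
      then obtain x where x: "x \<in> I" "x \<notin> B" using I by blast
      then obtain C where "is_circuit M C" "C \<subseteq> insert x B"
        using B(3) indeps_subset_ground[OF I(1)] by blast
      then show False using circuit_not_subset_indep[OF _ I(1), of C] x I(2) by blast
    qed
  qed (rule B(2))
  with B(3) show thesis by (intro that[of B]) auto
qed

end

section \<open>Three parallel elements as a minor\<close>

text \<open>For independent \<open>J\<close> this is the contraction of \<open>J\<close> followed by
  restriction to \<open>T\<close>. The form is stable under both operations: an element
  \<open>e\<close> of \<open>T\<close> is a loop exactly when \<open>insert e J\<close> is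
  dependent, and then contracting it only shrinks \<open>T\<close>.\<close>

definition minor :: "'a indep_system \<Rightarrow> 'a set \<Rightarrow> 'a set \<Rightarrow> 'a indep_system" where
  "minor M J T = \<lparr>ground = T, indeps = {I. I \<subseteq> T \<and> I \<union> J \<in> indeps M}\<rparr>"

lemma delete_minor: "matroid_delete (minor M J T) e = minor M J (T - {e})"
  by (auto simp: matroid_delete_def minor_def)

lemma contract_minor:
  assumes "e \<in> T"
  shows "matroid_contract (minor M J T) e =
    (if insert e J \<in> indeps M then minor M (insert e J) (T - {e}) else minor M J (T - {e}))"
proof -
  have "matroid_contract (minor M J T) e = minor M (insert e J) (T - {e})" if "insert e J \<in> indeps M"
    using assms that by (auto simp: matroid_contract_def minor_def)
  moreover have "matroid_contract (minor M J T) e = minor M J (T - {e})" if "insert e J \<notin> indeps M"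
    unfolding delete_minor[symmetric] using that by (auto simp: matroid_contract_def minor_def)
  ultimately show ?thesis by simp
qed

context matroid
begin

lemma minor_trivial: "minor M {} (ground M) = M"
  using indeps_subset_ground by (intro indep_system.equality) (auto simp: minor_def)

lemma reduces_to_imp_minor:
  assumes "reduces_to M N"
  obtains J T where "T \<subseteq> ground M" "J \<subseteq> ground M - T" "N = minor M J T"
proof -
  have "\<exists>J T. T \<subseteq> ground M \<and> J \<subseteq> ground M - T \<and> N = minor M J T"
    using assms
  proof induction
    case refl
    then show ?case using minor_trivial by (metis empty_subsetI order_refl)
  next
    case (delete N e)
    then obtain J T where "T \<subseteq> ground M" "J \<subseteq> ground M - T" "N = minor M J T" by blast
    then show ?case
      by (intro exI[of _ J] exI[of _ "T - {e}"]) (auto simp: delete_minor)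
  next
    case (contract N e)
    then obtain J T where N: "T \<subseteq> ground M" "J \<subseteq> ground M - T" "N = minor M J T" by blast
    then have e: "e \<in> T" using contract.hyps by (simp add: minor_def)
    show ?case
    proof (cases "insert e J \<in> indeps M")
      case True
      then show ?thesis using N e
        by (intro exI[of _ "insert e J"] exI[of _ "T - {e}"]) (auto simp: contract_minor)
    next
      case False
      then show ?thesis using N e
        by (intro exI[of _ J] exI[of _ "T - {e}"]) (auto simp: contract_minor)
    qed
  qed
  then show thesis using that by blast
qed

text \<open>All subsets of \<open>J\<close> are independent, so contracting its elements one by one
  never meets the loop convention.\<close>

lemma reduces_to_contract_set:
  assumes "finite J" "J \<in> indeps M"
  shows "reduces_to M (minor M J (ground M - J))"
  using assms
proof (induction J)
  case empty
  then show ?case using reduces_to.refl[of M] by (simp add: minor_trivial)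
next
  case (insert e J)
  have "reduces_to M (minor M J (ground M - J))"
    using insert.IH insert.prems indep_subset by blast
  moreover have e: "e \<in> ground M - J" using insert indeps_subset_ground by blast
  ultimately have "reduces_to M (matroid_contract (minor M J (ground M - J)) e)"
    by (intro reduces_to.contract) (simp_all add: minor_def)
  moreover have "ground M - J - {e} = ground M - insert e J" by blast
  ultimately show ?case using insert.prems(1) by (simp only: contract_minor[OF e] if_True)
qed

lemma reduces_to_minor:
  assumes "J \<in> indeps M" "T \<subseteq> ground M - J"
  shows "reduces_to M (minor M J T)"
proof -
  have "S \<subseteq> ground M - J \<Longrightarrow> reduces_to M (minor M J (ground M - J - S))" if "finite S" for S
    using that
  proof (induction S)
    case empty
    then show ?case using reduces_to_contract_set[OF indep_finite] assms(1) by simp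
  next
    case (insert e S)
    then have "reduces_to M (matroid_delete (minor M J (ground M - J - S)) e)"
      by (intro reduces_to.delete) (auto simp: minor_def)
    moreover have "ground M - J - S - {e} = ground M - J - insert e S" by blast
    ultimately show ?case by (simp only: delete_minor)
  qed
  from this[of "ground M - J - T"] show ?thesis
    using assms finite_ground by (simp add: double_diff)
qed

end

text \<open>Three elements \<open>a\<close>, \<open>b\<close>, \<open>c\<close> are pairwise
  parallel over the contracted set \<open>J\<close>. The pairs \<open>a\<close>, \<open>b\<close>
  and \<open>c\<close>, \<open>b\<close> close circuits with \<open>J\<close>; both pass through
  \<open>b\<close>, since \<open>a\<close> or \<open>c\<close> alone is independent over
  \<open>J\<close>, and only the second contains \<open>c\<close>.\<close>

lemma (in matroid) has_minor_U31_imp_circuits: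
  assumes "has_minor M U31"
  obtains C D where "is_circuit M C" "is_circuit M D" "C \<noteq> D" "C \<inter> D \<noteq> {}"
proof -
  obtain N f where N: "reduces_to M N" and f: "bij_betw f (ground N) (ground U31)"
    and iso: "\<And>X. X \<subseteq> ground N \<Longrightarrow> X \<in> indeps N \<longleftrightarrow> f ` X \<in> indeps U31"
    using assms by (auto simp: has_minor_def matroid_iso_def)
  obtain J T where "T \<subseteq> ground M" "J \<subseteq> ground M - T" "N = minor M J T"
    using reduces_to_imp_minor[OF N] .
  then have J: "ground N \<subseteq> ground M" "J \<subseteq> ground M - ground N"
    "indeps N = {I. I \<subseteq> ground N \<and> I \<union> J \<in> indeps M}"
    by (simp_all add: minor_def)
  have U: "ground U31 = {1, 2, 3}" "indeps U31 = {I. I \<subseteq> {1, 2, 3} \<and> card I \<le> 1}"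
    by (auto simp: U31_def uniform_matroid_def)
  obtain a b c where abc: "a \<in> ground N" "b \<in> ground N" "c \<in> ground N" "f a = 1" "f b = 2" "f c = 3"
  proof -
    have "f ` ground N = {1, 2, 3}" using f U(1) by (simp add: bij_betw_def)
    then have "1 \<in> f ` ground N" "2 \<in> f ` ground N" "3 \<in> f ` ground N" by auto
    with that show thesis by (elim imageE) auto
  qed
  have ne: "a \<noteq> b" "a \<noteq> c" "b \<noteq> c" using abc by auto
  have sing: "insert x J \<in> indeps M" if "x \<in> {a, b, c}" for x
    using iso[of "{x}"] that abc U J(3) by auto
  have pair: "insert x (insert y J) \<notin> indeps M" if "x \<in> {a, b, c}" "y \<in> {a, b, c}" "x \<noteq> y" for x y
    using iso[of "{x, y}"] that abc U J(3) by auto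
  obtain C where C: "is_circuit M C" "C \<subseteq> insert a (insert b J)" "a \<in> C"
    using circuit_in_insert[of "insert b J" a] sing pair[of a b] ne abc J(1) by auto
  obtain D where D: "is_circuit M D" "D \<subseteq> insert c (insert b J)" "c \<in> D"
    using circuit_in_insert[of "insert b J" c] sing pair[of c b] ne abc J(1) by auto
  have "b \<in> C" using circuit_not_subset_indep[OF C(1) sing[of a]] C(2) by auto
  moreover have "b \<in> D" using circuit_not_subset_indep[OF D(1) sing[of c]] D(2) by auto
  moreover have "c \<notin> C" using C(2) ne abc J(2) by auto
  ultimately show thesis using that C D by blast
qed

text \<open>Contracting \<open>B - {b}\<close> for a basis \<open>B\<close> of \<open>C1 \<union> C2\<close> makes \<open>b\<close>, \<open>g\<close>, \<open>h\<close> parallel as soon as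
  \<open>b\<close> lies on the fundamental circuits of both \<open>g\<close> and \<open>h\<close>.\<close>

lemma (in matroid) circuits_imp_has_minor_U31:
  assumes C1: "is_circuit M C1" and C2: "is_circuit M C2" and "C1 \<noteq> C2" "C1 \<inter> C2 \<noteq> {}"
  shows "has_minor M U31"
proof -
  obtain g where g: "g \<in> C1" "g \<notin> C2" using circuit_subset_eq[OF C1 C2] assms(3) by blast
  obtain B where B: "C1 - {g} \<subseteq> B" "B \<subseteq> C1 \<union> C2" "B \<in> indeps M"
    and Bmax: "\<And>x. x \<in> C1 \<union> C2 \<Longrightarrow> x \<notin> B \<Longrightarrow> insert x B \<notin> indeps M"
    using extend_to_maximal[OF circuit_remove_indep[OF C1 g(1)], of "C1 \<union> C2"] by blast
  have gB: "g \<notin> B" using circuit_not_subset_indep[OF C1 B(3)] B(1) by blast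
  obtain h where h: "h \<in> C2" "h \<notin> B" using circuit_not_subset_indep[OF C2 B(3)] by blast
  have hC: "h \<notin> C1" "g \<noteq> h" using h g B(1) by auto
  have G: "g \<in> ground M" "h \<in> ground M" "B \<subseteq> ground M"
    using g h C1 C2 circuit_subset_ground B(3) indeps_subset_ground by auto
  obtain D where D: "is_circuit M D" "D \<subseteq> insert h B" "h \<in> D"
    using circuit_in_insert[OF B(3) G(2)] Bmax h by blast
  \<comment> \<open>If \<open>D\<close> met \<open>C1\<close> at most in \<open>g\<close>, it would
    lie in \<open>C2\<close> and hence equal \<open>C2\<close>. Then \<open>C1\<close> and
    \<open>C2\<close> could share only \<open>g\<close>, which is not in \<open>C2\<close>.\<close>
  obtain b where b: "b \<in> D" "b \<in> C1" "b \<noteq> g"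
  proof (rule ccontr)
    assume "\<not> thesis"
    with that have *: "\<And>b. b \<in> D \<Longrightarrow> b \<in> C1 \<Longrightarrow> b = g" by blast
    have "D \<subseteq> C2" using * D(2) B(2) h gB by blast
    then have "D = C2" using circuit_subset_eq D(1) C2 by blast
    then show False using * assms(4) g by blast
  qed
  have bB: "b \<in> B" "b \<noteq> h" using b B(1) hC by auto
  let ?J = "B - {b}"
  have J: "?J \<in> indeps M" using B(3) indep_subset by blast
  have indep_b: "insert b ?J \<in> indeps M" using B(3) bB by (simp add: insert_absorb)
  \<comment> \<open>A circuit inside \<open>insert x ?J\<close> would be the fundamental circuit of
    \<open>x\<close> over \<open>B\<close>, but that one contains \<open>b\<close>.\<close>
  have indep: "insert x ?J \<in> indeps M"
    if x: "is_circuit M A" "A \<subseteq> insert x B" "b \<in> A" "x \<in> ground M" "x \<notin> B" for x A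
  proof (rule ccontr)
    assume "insert x ?J \<notin> indeps M"
    then obtain A' where A': "is_circuit M A'" "A' \<subseteq> insert x ?J"
      using circuit_in_insert[OF J x(4)] by blast
    then have "A' = A" using fund_circuit_unique[OF B(3) A'(1) x(1)] x(2) by blast
    then show False using A'(2) x(3,5) bB by blast
  qed
  have C1sub: "C1 \<subseteq> insert g B" using B(1) by blast
  have indep_g: "insert g ?J \<in> indeps M" using indep[OF C1 C1sub b(2) G(1) gB] .
  have indep_h: "insert h ?J \<in> indeps M" using indep[OF D(1,2) b(1) G(2) h(2)] .
  have dep_bg: "insert b (insert g ?J) \<notin> indeps M"
    using circuit_not_subset_indep[OF C1] C1sub by (metis insert_Diff insert_commute bB(1))
  have dep_bh: "insert b (insert h ?J) \<notin> indeps M"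
    using circuit_not_subset_indep[OF D(1)] D(2) by (metis insert_Diff insert_commute bB(1))
  \<comment> \<open>The elements \<open>g\<close> and \<open>h\<close> are parallel to each other
    because eliminating \<open>b\<close> leaves a circuit inside \<open>?J\<close> together with
    \<open>g\<close> and \<open>h\<close>.\<close>
  have "C1 \<noteq> D" using hC D(3) by blast
  then obtain A where A: "is_circuit M A" "A \<subseteq> C1 \<union> D - {b}"
    using circuit_elimination[OF C1 D(1) _ b(2,1)] by blast
  then have dep_gh: "insert g (insert h ?J) \<notin> indeps M"
    using circuit_not_subset_indep[OF A(1), of "insert g (insert h ?J)"] C1sub D(2) by blast
  define T where "T = {b, g, h}"
  have T: "T \<subseteq> ground M - ?J" using G bB gB h by (auto simp: T_def)
  have indep_T: "insert x ?J \<in> indeps M" if "x \<in> T" for x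
    using that indep_b indep_g indep_h by (auto simp: T_def)
  have dep_T: "insert x (insert y ?J) \<notin> indeps M" if "x \<in> T" "y \<in> T" "x \<noteq> y" for x y
    using that dep_bg dep_bh dep_gh unfolding T_def by (metis empty_iff insert_commute insert_iff)
  have "card T = card {1::nat, 2, 3}" using b gB bB hC by (auto simp: T_def)
  moreover have "finite T" by (simp add: T_def)
  ultimately obtain f where f: "bij_betw f T {1::nat, 2, 3}"
    using finite_same_card_bij[of T "{1::nat, 2, 3}"] by blast
  have "X \<in> indeps (minor M ?J T) \<longleftrightarrow> f ` X \<in> indeps U31" if X: "X \<subseteq> T" for X
  proof -
    have "finite X" using X by (simp add: T_def finite_subset)
    have "f ` X \<subseteq> {1, 2, 3}" "card (f ` X) = card X"
      using f X inj_on_subset[of f T X] card_image[of f X] by (auto simp: bij_betw_def)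
    then have "f ` X \<in> indeps U31 \<longleftrightarrow> card X \<le> 1"
      by (simp add: U31_def uniform_matroid_def)
    also have "\<dots> \<longleftrightarrow> X \<union> ?J \<in> indeps M"
    proof
      assume "card X \<le> 1"
      then have "X = {} \<or> (\<exists>x. X = {x})" using \<open>finite X\<close> by (auto simp: le_Suc_eq card_Suc_eq)
      then show "X \<union> ?J \<in> indeps M" using X J indep_T by auto
    next
      assume *: "X \<union> ?J \<in> indeps M"
      have "x = y" if xy: "x \<in> X" "y \<in> X" for x y
      proof (rule ccontr)
        assume "x \<noteq> y"
        then have "insert x (insert y ?J) \<notin> indeps M" using dep_T X xy by blast
        moreover have "insert x (insert y ?J) \<subseteq> X \<union> ?J" using xy by blast
        ultimately show False using * indep_subset by blast
      qed
      then show "card X \<le> 1" using card_le_Suc0_iff_eq[OF \<open>finite X\<close>] by auto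
    qed
    finally show ?thesis using X by (simp add: minor_def)
  qed
  then have "matroid_iso (minor M ?J T) U31"
    using f unfolding matroid_iso_def
    by (intro exI[of _ f]) (simp add: minor_def U31_def uniform_matroid_def)
  then show ?thesis
    using reduces_to_minor[OF J T] unfolding has_minor_def by blast
qed

section \<open>Removing faces whose link is a cone\<close>

lemma topspace_realization:
  "topspace (realization K) = {x. (\<forall>v. 0 \<le> x v) \<and> {v. x v \<noteq> 0} \<in> K \<and> (\<Sum>v | x v \<noteq> 0. x v) = 1}"
  by (simp add: realization_def)

lemma continuous_map_into_realization:
  "continuous_map X (realization K) f \<longleftrightarrow>
    (\<forall>v. continuous_map X euclideanreal (\<lambda>x. f x v)) \<and> f \<in> topspace X \<rightarrow> topspace (realization K)"
  unfolding topspace_realization unfolding realization_def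
  by (auto simp: continuous_map_in_subtopology continuous_map_componentwise_UNIV)

lemma continuous_map_realization_coordinate:
  "continuous_map (realization K) euclideanreal (\<lambda>x. x v)"
  unfolding realization_def by (intro continuous_intros) auto

lemma continuous_map_Min:
  fixes f :: "'a \<Rightarrow> 'v \<Rightarrow> real"
  assumes "finite I" "I \<noteq> {}" "\<And>i. i \<in> I \<Longrightarrow> continuous_map X euclideanreal (\<lambda>x. f x i)"
  shows "continuous_map X euclideanreal (\<lambda>x. Min (f x ` I))"
  using assms
proof (induction rule: finite_ne_induct)
  case (insert i I)
  have "continuous_map X euclideanreal (\<lambda>x. min (f x i) (Min (f x ` I)))"
    using insert by (intro continuous_map_real_min) auto
  then show ?case using insert by simp
qed auto

text \<open>Summing over a fixed \<open>V\<close> instead of the support makes the condition linear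
  in \<open>x\<close>, as needed for points moving between faces.\<close>

lemma in_realization_iff:
  assumes "finite V" "{v. x v \<noteq> 0} \<subseteq> V"
  shows "x \<in> topspace (realization K) \<longleftrightarrow> (\<forall>v. 0 \<le> x v) \<and> {v. x v \<noteq> 0} \<in> K \<and> sum x V = 1"
proof -
  have "sum x {v. x v \<noteq> 0} = sum x V" using assms by (intro sum.mono_neutral_left) auto
  then show ?thesis by (simp add: topspace_realization)
qed

text \<open>By \<open>common\<close>, \<open>x\<close> and \<open>f x\<close> lie in one closed
  simplex of \<open>K\<close>, which contains the segment between them.\<close>

lemma homotopic_id_straight_line:
  assumes fin: "finite V" "K \<subseteq> Pow V"
    and down: "\<And>F G. F \<in> K \<Longrightarrow> G \<subseteq> F \<Longrightarrow> G \<in> K"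
    and f: "continuous_map (realization K) (realization K) f"
    and common: "\<And>x. x \<in> topspace (realization K) \<Longrightarrow> {v. x v \<noteq> 0} \<union> {v. f x v \<noteq> 0} \<in> K"
  shows "homotopic_with (\<lambda>_. True) (realization K) (realization K) id f"
proof -
  let ?X = "realization K"
  let ?h = "\<lambda>(t, x) v. (1 - t) * x v + t * f x v"
  let ?P = "prod_topology (top_of_set {0..1::real}) ?X"
  have "continuous_map ?P ?X ?h"
    unfolding continuous_map_into_realization
  proof (intro conjI allI)
    fix v
    have t: "continuous_map ?P euclideanreal fst"
      by (meson continuous_map_fst continuous_map_into_fulltopology)
    have x: "continuous_map ?P euclideanreal (\<lambda>p. snd p v)"
      using continuous_map_compose[OF continuous_map_snd continuous_map_realization_coordinate]
      by (simp add: o_def)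
    have "continuous_map ?X euclideanreal (\<lambda>x. f x v)"
      using continuous_map_into_realization[THEN iffD1, OF f] by simp
    from continuous_map_compose[OF continuous_map_snd this]
    have "continuous_map ?P euclideanreal (\<lambda>p. f (snd p) v)"
      by (simp add: o_def)
    then have "continuous_map ?P euclideanreal (\<lambda>p. (1 - fst p) * snd p v + fst p * f (snd p) v)"
      using t x by (intro continuous_intros) auto
    then show "continuous_map ?P euclideanreal (\<lambda>p. ?h p v)"
      by (simp add: case_prod_unfold)
  next
    show "?h \<in> topspace ?P \<rightarrow> topspace ?X"
    proof (rule Pi_I, clarify)
      fix t :: real and x assume "(t, x) \<in> topspace ?P"
      then have t: "0 \<le> t" "t \<le> 1" and x: "x \<in> topspace ?X" by auto
      have fx: "f x \<in> topspace ?X" using f x continuous_map_funspace by blast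
      have V: "{v. x v \<noteq> 0} \<subseteq> V" "{v. f x v \<noteq> 0} \<subseteq> V" using common[OF x] fin(2) by auto
      let ?y = "\<lambda>v. (1 - t) * x v + t * f x v"
      have x': "\<And>v. 0 \<le> x v" "sum x V = 1" and fx': "\<And>v. 0 \<le> f x v" "sum (f x) V = 1"
        using x fx in_realization_iff[OF fin(1) V(1), of K] in_realization_iff[OF fin(1) V(2), of K] by auto
      have sub: "{v. ?y v \<noteq> 0} \<subseteq> {v. x v \<noteq> 0} \<union> {v. f x v \<noteq> 0}" by auto
      have "sum ?y V = (1 - t) * sum x V + t * sum (f x) V"
        by (simp add: sum.distrib sum_distrib_left)
      then have "sum ?y V = 1" using x' fx' by simp
      moreover have "\<forall>v. 0 \<le> ?y v" using x' fx' t by simp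
      ultimately show "?y \<in> topspace ?X"
        using in_realization_iff[OF fin(1), of ?y K] sub V down[OF common[OF x] sub] by blast
    qed
  qed
  then show ?thesis
    unfolding homotopic_with_def by (intro exI[of _ ?h]) auto
qed

text \<open>Each point moves straight to the vertex \<open>w\<close> inside the simplex spanned by
  its support and \<open>w\<close>. The family without any face is treated apart, as it has no
  vertex \<open>w\<close>.\<close>

lemma contractible_cone:
  assumes "finite V" "K \<subseteq> Pow V"
    and down: "\<And>F G. F \<in> K \<Longrightarrow> G \<subseteq> F \<Longrightarrow> G \<in> K"
    and cone: "\<And>F. F \<in> K \<Longrightarrow> insert w F \<in> K"
  shows "contractible_space (realization K)"
proof (cases "K = {}")
  case True
  then have "topspace (realization K) = {}" by (simp add: topspace_realization)
  then show ?thesis by (metis contractible_space_empty null_topspace_iff_trivial)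
next
  case False
  let ?e = "\<lambda>v. if v = w then 1 else (0::real)"
  have e: "{v. ?e v \<noteq> 0} = {w}" by auto
  have "{w} \<in> K" using False cone down by (metis all_not_in_conv empty_subsetI insert_subsetI insertI1)
  then have "?e \<in> topspace (realization K)" by (simp add: topspace_realization e)
  then have const: "continuous_map (realization K) (realization K) (\<lambda>_. ?e)" by simp
  have "homotopic_with (\<lambda>_. True) (realization K) (realization K) id (\<lambda>_. ?e)"
  proof (rule homotopic_id_straight_line[OF assms(1,2) _ const])
    show "{v. x v \<noteq> 0} \<union> {v. ?e v \<noteq> 0} \<in> K" if "x \<in> topspace (realization K)" for x
      using that cone by (simp add: e topspace_realization)
  qed (rule down)
  then show ?thesis unfolding contractible_space_def by blast
qed

text \<open>The retraction subtracts \<open>m = min\<^sub>R x\<close> from every coordinate in \<open>R\<close> and moves the mass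
  \<open>|R| m\<close> to \<open>w\<close>; it fixes exactly the points whose support does not contain \<open>R\<close>.\<close>

lemma contractible_remove_face:
  assumes fin: "finite V" "K \<subseteq> Pow V"
    and down: "\<And>F G. F \<in> K \<Longrightarrow> G \<subseteq> F \<Longrightarrow> G \<in> K"
    and R: "finite R" "R \<noteq> {}" "w \<notin> R"
    and cone: "\<And>F. F \<in> K \<Longrightarrow> R \<subseteq> F \<Longrightarrow> insert w F \<in> K"
    and contr: "contractible_space (realization {F \<in> K. \<not> R \<subseteq> F})"
  shows "contractible_space (realization K)"
proof -
  let ?L = "{F \<in> K. \<not> R \<subseteq> F}"
  define m :: "('a \<Rightarrow> real) \<Rightarrow> real" where "m x = Min (x ` R)" for x
  define \<rho> where "\<rho> x = (\<lambda>v. if v = w then x v + card R * m x else if v \<in> R then x v - m x else x v)"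
    for x :: "'a \<Rightarrow> real"
  have m_le: "m x \<le> x v" if "v \<in> R" for x v using that R by (auto simp: m_def)
  have m_ex: "\<exists>v\<in>R. x v = m x" for x
  proof -
    have "m x \<in> x ` R" unfolding m_def using R by (intro Min_in) auto
    then show ?thesis by auto
  qed
  have m_nonneg: "0 \<le> m x" if "\<And>v. 0 \<le> x v" for x using m_ex[of x] that by metis
  have m_zero: "m x = 0" if "\<And>v. 0 \<le> x v" "\<not> R \<subseteq> {v. x v \<noteq> 0}" for x
    using m_le[of _ x] m_nonneg[of x] that by (metis (mono_tags) mem_Collect_eq nle_le subsetI)
  have fixed: "\<rho> x = x" if "x \<in> topspace (realization ?L)" for x
    using m_zero[of x] that by (auto simp: \<rho>_def topspace_realization)
  have into: "\<rho> x \<in> topspace (realization ?L) \<and> {v. x v \<noteq> 0} \<union> {v. \<rho> x v \<noteq> 0} \<in> K"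
    if x: "x \<in> topspace (realization K)" for x
  proof (cases "R \<subseteq> {v. x v \<noteq> 0}")
    case False
    then have L: "x \<in> topspace (realization ?L)" using x by (simp add: topspace_realization)
    then show ?thesis using fixed[OF L] by (simp add: topspace_realization)
  next
    case True
    let ?S = "{v. x v \<noteq> 0}"
    have S: "?S \<in> K" and nonneg: "\<And>v. 0 \<le> x v" using x by (auto simp: topspace_realization)
    have wS: "insert w ?S \<in> K" by (rule cone[OF S True])
    have sub: "{v. \<rho> x v \<noteq> 0} \<subseteq> insert w ?S" using True by (auto simp: \<rho>_def split: if_splits)
    have V: "?S \<subseteq> V" "w \<in> V" "{v. \<rho> x v \<noteq> 0} \<subseteq> V" "R \<subseteq> V" using wS sub True fin(2) by auto
    have "sum x V = 1" using x in_realization_iff[OF fin(1) V(1), of K] by blast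
    have "(\<lambda>v. \<rho> x v) = (\<lambda>v. x v + (if v = w then card R * m x else 0) - (if v \<in> R then m x else 0))"
      using R(3) by (auto simp: \<rho>_def)
    then have "sum (\<rho> x) V = sum x V + (\<Sum>v\<in>V. if v = w then card R * m x else 0) - (\<Sum>v\<in>V. if v \<in> R then m x else 0)"
      by (simp add: sum.distrib sum_subtractf)
    also have "\<dots> = 1"
      using \<open>sum x V = 1\<close> fin(1) V(2,4) by (simp add: sum.If_cases Int_absorb1)
    finally have "sum (\<rho> x) V = 1" .
    moreover have "0 \<le> \<rho> x v" for v
      using m_le[of v x] m_nonneg[of x] nonneg by (auto simp: \<rho>_def)
    \<comment> \<open>The coordinate at which the minimum is attained drops to zero, so the new
      support no longer contains \<open>R\<close>.\<close>
    moreover obtain u where u: "u \<in> R" "x u = m x" using m_ex by blast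
    then have "\<rho> x u = 0" using R(3) by (auto simp: \<rho>_def)
    then have "{v. \<rho> x v \<noteq> 0} \<in> ?L" using down[OF wS sub] u(1) by blast
    ultimately have "\<rho> x \<in> topspace (realization ?L)"
      using in_realization_iff[OF fin(1) V(3), of ?L] by blast
    then show ?thesis using down[OF wS, of "?S \<union> {v. \<rho> x v \<noteq> 0}"] sub by blast
  qed
  have coord: "continuous_map (realization K) euclideanreal (\<lambda>x. x v)" for K and v :: 'a
    by (rule continuous_map_realization_coordinate)
  \<comment> \<open>Since \<open>m\<close> vanishes by itself where the support misses part of
    \<open>R\<close>, one formula serves on all of \<open>K\<close> and no gluing is
    involved.\<close>
  have "continuous_map (realization K) euclideanreal m"
    unfolding m_def using R coord by (intro continuous_map_Min) auto
  then have cont: "continuous_map (realization K) euclideanreal (\<lambda>x. \<rho> x v)" for v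
    unfolding \<rho>_def using coord by (auto intro!: continuous_intros)
  have LK: "topspace (realization ?L) \<subseteq> topspace (realization K)" by (auto simp: topspace_realization)
  have contK: "continuous_map (realization K) (realization K) \<rho>"
    and contL: "continuous_map (realization K) (realization ?L) \<rho>"
    and incl: "continuous_map (realization ?L) (realization K) id"
    using cont into coord LK by (auto simp: continuous_map_into_realization)
  have "homotopic_with (\<lambda>_. True) (realization K) (realization K) id \<rho>"
    using into by (intro homotopic_id_straight_line[OF fin down contK]) auto
  then have "realization K homotopy_equivalent_space realization ?L"
    using contL incl fixed
    by (intro deformation_retract_imp_homotopy_equivalent_space[of _ \<rho>])
       (auto simp: retraction_maps_def homotopic_with_sym)
  then show ?thesis using contr homotopy_equivalent_space_contractibility by blast
qed

text \<open>Adding \<open>w\<close> to a face that avoids some \<open>R\<close> keeps it avoiding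
  \<open>R\<close>, because \<open>w\<close> lies in none of these sets. Hence the cone condition
  survives every removal, and the sets can be treated one at a time.\<close>

lemma contractible_remove_faces:
  assumes "finite \<R>" and fin: "finite V" "K \<subseteq> Pow V"
    and down: "\<And>F G. F \<in> K \<Longrightarrow> G \<subseteq> F \<Longrightarrow> G \<in> K"
    and R: "\<And>R. R \<in> \<R> \<Longrightarrow> finite R \<and> R \<noteq> {} \<and> w \<notin> R"
    and cone: "\<And>R F. R \<in> \<R> \<Longrightarrow> F \<in> K \<Longrightarrow> R \<subseteq> F \<Longrightarrow> insert w F \<in> K"
    and contr: "contractible_space (realization {F \<in> K. \<forall>R\<in>\<R>. \<not> R \<subseteq> F})"
  shows "contractible_space (realization K)"
  using assms(1) R cone contr
proof (induction \<R>)
  case (insert R \<R>)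
  let ?L = "{F \<in> K. \<forall>R\<in>\<R>. \<not> R \<subseteq> F}"
  have "{F \<in> ?L. \<not> R \<subseteq> F} = {F \<in> K. \<forall>R\<in>insert R \<R>. \<not> R \<subseteq> F}" by auto
  then have contr': "contractible_space (realization {F \<in> ?L. \<not> R \<subseteq> F})" using insert.prems(3) by simp
  have "contractible_space (realization ?L)"
  proof (rule contractible_remove_face[OF fin(1) _ _ _ _ _ _ contr'])
    show "insert w F \<in> ?L" if F: "F \<in> ?L" "R \<subseteq> F" for F
    proof -
      have "\<not> R' \<subseteq> insert w F" if "R' \<in> \<R>" for R'
        using insert.prems(1)[of R'] that F by (auto simp: subset_insert)
      then show ?thesis using insert.prems(2)[of R F] F by blast
    qed
    show "?L \<subseteq> Pow V" using fin(2) by blast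
    show "G \<in> ?L" if "F \<in> ?L" "G \<subseteq> F" for F G using down[of F G] that by blast
    show "finite R" "R \<noteq> {}" "w \<notin> R" using insert.prems(1)[of R] by simp_all
  qed
  then show ?case using insert.IH insert.prems(1,2) by blast
qed simp

section \<open>Joins of boundaries of simplices\<close>

text \<open>On each block \<open>N\<close> the points are the nonnegative vectors with some zero
  coordinate. Subtracting the base coordinate identifies these vectors with all real vectors on the
  other elements of \<open>N\<close>; the inverse subtracts the minimum, with the base coordinate
  set to zero. Both maps commute with scaling by nonnegative factors, so they pass to the slices of
  coordinate sum 1 and Euclidean norm 1.\<close>

lemma join_of_simplex_boundaries_sphere:
  assumes fin: "finite \<N>" "\<And>N. N \<in> \<N> \<Longrightarrow> finite N" "\<And>N. N \<in> \<N> \<Longrightarrow> N \<noteq> {}"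
    and disj: "\<And>N N'. N \<in> \<N> \<Longrightarrow> N' \<in> \<N> \<Longrightarrow> N \<noteq> N' \<Longrightarrow> N \<inter> N' = {}"
  shows "homeomorphic_to_sphere (realization {F. F \<subseteq> \<Union>\<N> \<and> (\<forall>N\<in>\<N>. \<not> N \<subseteq> F)})"
proof -
  define K where "K = {F. F \<subseteq> \<Union>\<N> \<and> (\<forall>N\<in>\<N>. \<not> N \<subseteq> F)}"
  define V where "V = \<Union>\<N>"
  define b where "b N = (SOME v. v \<in> N)" for N :: "'a set"
  define W where "W = V - b ` \<N>"
  define block where "block v = (THE N. N \<in> \<N> \<and> v \<in> N)" for v
  have finV: "finite V" using fin by (simp add: V_def)
  have b: "b N \<in> N" if "N \<in> \<N>" for N using fin(3)[OF that] by (auto simp: b_def some_in_eq)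
  have block_eq: "block v = N" if "N \<in> \<N>" "v \<in> N" for v N
    unfolding block_def using that disj by (intro the_equality) blast+
  have block: "block v \<in> \<N>" "v \<in> block v" if "v \<in> V" for v
    using that block_eq by (auto simp: V_def)
  have mem_K: "x \<in> topspace (realization K) \<longleftrightarrow>
      (\<forall>v. 0 \<le> x v) \<and> (\<forall>v. v \<notin> V \<longrightarrow> x v = 0) \<and> (\<forall>N\<in>\<N>. \<exists>v\<in>N. x v = 0) \<and> sum x V = 1" for x
  proof (cases "{v. x v \<noteq> 0} \<subseteq> V")
    case True
    have "{v. x v \<noteq> 0} \<in> K \<longleftrightarrow> (\<forall>N\<in>\<N>. \<exists>v\<in>N. x v = 0)"
      using True by (auto simp: K_def V_def)
    then show ?thesis using in_realization_iff[OF finV True, of K] True by auto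
  next
    case False
    then show ?thesis by (auto simp: K_def V_def topspace_realization)
  qed
  show ?thesis
  proof (cases "card W")
    \<comment> \<open>Every block is a single vertex, whose coordinate must vanish, so no point has
      coordinate sum 1. This is the sphere of dimension -1.\<close>
    case 0
    then have "W = {}" using finV by (simp add: W_def)
    then have single: "N = {b N}" if "N \<in> \<N>" for N
    proof -
      have "u = b N" if u: "u \<in> N" for u
      proof -
        have "u \<in> b ` \<N>" using \<open>W = {}\<close> u \<open>N \<in> \<N>\<close> unfolding W_def V_def by blast
        then obtain N' where "N' \<in> \<N>" "u = b N'" by blast
        then show ?thesis using b[of N'] disj[of N N'] u \<open>N \<in> \<N>\<close> by blast
      qed
      then show ?thesis using b[OF that] by blast
    qed
    have "x v = 0" if "x \<in> topspace (realization K)" for x v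
    proof (cases "v \<in> V")
      case True
      then have N: "block v \<in> \<N>" "v \<in> block v" using block by auto
      then obtain u where "u \<in> block v" "x u = 0" using \<open>x \<in> _\<close> mem_K[of x] by blast
      then show ?thesis using single[OF N(1)] N(2) by (metis singletonD)
    next
      case False
      then show ?thesis using that mem_K[of x] by blast
    qed
    moreover have "x \<notin> topspace (realization K)" if "\<And>v. x v = 0" for x
      using mem_K[of x] that by simp
    ultimately have "topspace (realization K) = {}" by blast
    then show ?thesis by (simp add: homeomorphic_to_sphere_def K_def)
  next
    case (Suc n)
    have finW: "finite W" using finV by (simp add: W_def)
    obtain \<sigma> where \<sigma>: "bij_betw \<sigma> {..n} W"
      using finite_same_card_bij[of "{..n}" W] finW Suc by auto
    define \<tau> where "\<tau> = the_inv_into {..n} \<sigma>"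
    have \<tau>: "\<tau> v \<le> n" "\<sigma> (\<tau> v) = v" if "v \<in> W" for v
      using \<sigma> that f_the_inv_into_f_bij_betw[OF \<sigma>] the_inv_into_into[of \<sigma> "{..n}" v "{..n}"]
      by (auto simp: \<tau>_def bij_betw_def)
    have \<sigma>W: "\<sigma> i \<in> W" "\<tau> (\<sigma> i) = i" if "i \<le> n" for i
      using \<sigma> that the_inv_into_f_f[of \<sigma> "{..n}" i] by (auto simp: \<tau>_def bij_betw_def)
    have WV: "W \<subseteq> V" by (auto simp: W_def)
    have bW: "b N \<notin> W" "b N \<in> V" if "N \<in> \<N>" for N using that b by (auto simp: W_def V_def)
    \<comment> \<open>The maps \<open>d\<close> and \<open>g\<close> are the mutually inverse maps
      before normalization, \<open>F\<close> and \<open>G\<close> their normalizations. The vector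
      \<open>z\<close> is indexed by \<open>{..n}\<close> through \<sigma>, and \<open>y z\<close>
      extends it by zero to the base elements.\<close>
    define y :: "(nat \<Rightarrow> real) \<Rightarrow> 'a \<Rightarrow> real" where "y z v = (if v \<in> W then z (\<tau> v) else 0)" for z v
    define \<mu> where "\<mu> z N = Min (y z ` N)" for z N
    define g where "g z v = (if v \<in> V then y z v - \<mu> z (block v) else 0)" for z v
    define G where "G z = (\<lambda>v. g z v / sum (g z) V)" for z
    define d where "d x i = (if i \<le> n then x (\<sigma> i) - x (b (block (\<sigma> i))) else 0)" for x :: "'a \<Rightarrow> real" and i
    define F where "F x = (\<lambda>i. d x i / sqrt (\<Sum>i\<le>n. (d x i)\<^sup>2))" for x
    have \<mu>_le: "\<mu> z N \<le> y z v" if "N \<in> \<N>" "v \<in> N" for z N v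
      using that fin(2) by (auto simp: \<mu>_def)
    have \<mu>_ex: "\<exists>v\<in>N. y z v = \<mu> z N" if "N \<in> \<N>" for z N
    proof -
      have "\<mu> z N \<in> y z ` N" unfolding \<mu>_def using fin(2,3)[OF that] by (intro Min_in) auto
      then show ?thesis by auto
    qed
    have g_nonneg: "0 \<le> g z v" for z v using \<mu>_le[of "block v" v z] block[of v] by (simp add: g_def)
    have d_g: "d (g z) i = z i" if "\<And>i. i > n \<Longrightarrow> z i = 0" for z i
    proof (cases "i \<le> n")
      case True
      have v: "\<sigma> i \<in> V" "\<sigma> i \<in> W" using \<sigma>W[OF True] WV by auto
      let ?N = "block (\<sigma> i)"
      have N: "?N \<in> \<N>" using block v by blast
      have "block (b ?N) = ?N" using block_eq[OF N b[OF N]] .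
      then show ?thesis using True v bW[OF N] \<sigma>W(2)[OF True] by (simp add: d_def g_def y_def)
    qed (use that in \<open>simp add: d_def\<close>)
    have g_d: "g (d x) v = x v"
      if x: "\<And>v. 0 \<le> x v" "\<And>v. v \<notin> V \<Longrightarrow> x v = 0" "\<And>N. N \<in> \<N> \<Longrightarrow> \<exists>v\<in>N. x v = 0" for x v
    proof (cases "v \<in> V")
      case True
      have y_d: "y (d x) u = x u - x (b (block u))" if u: "u \<in> V" for u
      proof (cases "u \<in> W")
        case True
        then show ?thesis using \<tau> by (simp add: y_def d_def)
      next
        case False
        then obtain N where "N \<in> \<N>" "u = b N" using u by (auto simp: W_def)
        then show ?thesis using False block_eq b by (simp add: y_def)
      qed
      let ?N = "block v"
      have N: "?N \<in> \<N>" using block True by blast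
      have y_N: "y (d x) u = x u - x (b ?N)" if "u \<in> ?N" for u
        using y_d[of u] block_eq[OF N that] that N by (auto simp: V_def)
      \<comment> \<open>The minimum of \<open>x\<close> on the block is 0, attained at the required
        zero coordinate; the shift by the base coordinate carries it to
        \<open>- x (b ?N)\<close>.\<close>
      have "\<mu> (d x) ?N = - x (b ?N)"
        unfolding \<mu>_def
      proof (rule Min_eqI)
        obtain u where "u \<in> ?N" "x u = 0" using x(3)[OF N] by blast
        then show "- x (b ?N) \<in> y (d x) ` ?N" using y_N by (metis diff_0 image_eqI)
      qed (use fin(2)[OF N] y_N x(1) in auto)
      then show ?thesis using True y_N[of v] block by (simp add: g_def)
    qed (simp add: g_def x)
    have y_scale: "y (\<lambda>i. c * z i) v = c * y z v" for c z v by (simp add: y_def)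
    have \<mu>_scale: "\<mu> (\<lambda>i. c * z i) N = c * \<mu> z N" if "0 \<le> c" "N \<in> \<N>" for c z N
    proof -
      have "mono ((*) c)" using that by (simp add: mono_def mult_left_mono)
      then show ?thesis
        using mono_Min_commute[of "(*) c" "y z ` N"] fin(2,3)[OF that(2)]
        by (simp add: \<mu>_def y_scale[abs_def] image_image)
    qed
    have g_scale: "g (\<lambda>i. c * z i) v = c * g z v" if "0 \<le> c" for c z v
      using \<mu>_scale[OF that] block by (simp add: g_def y_scale algebra_simps)
    have d_scale: "d (\<lambda>v. c * x v) i = c * d x i" for c x i
      by (simp add: d_def algebra_simps)
    have sphere: "z \<in> topspace (nsphere n) \<longleftrightarrow> (\<Sum>i\<le>n. (z i)\<^sup>2) = 1 \<and> (\<forall>i>n. z i = 0)" for z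
      by (simp add: nsphere)
    \<comment> \<open>A vanishing sum of nonnegative terms gives \<open>g z = 0\<close>, and
      applying \<open>d\<close> gives \<open>z = 0\<close>, which is not on the unit sphere.\<close>
    have g_pos: "0 < sum (g z) V" if z: "z \<in> topspace (nsphere n)" for z
    proof (rule ccontr)
      assume "\<not> 0 < sum (g z) V"
      then have "sum (g z) V = 0" using sum_nonneg[of V "g z"] g_nonneg by fastforce
      then have "\<forall>v\<in>V. g z v = 0" using sum_nonneg_eq_0_iff[OF finV] g_nonneg by blast
      then have "g z v = 0" for v by (cases "v \<in> V") (simp_all add: g_def)
      then have "d (g z) i = 0" for i by (simp add: d_def)
      then have "z i = 0" for i using d_g[of z i] z sphere by metis
      then show False using z sphere[of z] by simp
    qed
    have norm_pos: "0 < sqrt (\<Sum>i\<le>n. (d x i)\<^sup>2)" if x: "x \<in> topspace (realization K)" for x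
    proof (rule ccontr)
      assume "\<not> ?thesis"
      then have "(\<Sum>i\<le>n. (d x i)\<^sup>2) \<le> 0" by (simp add: not_less)
      then have "(\<Sum>i\<le>n. (d x i)\<^sup>2) = 0" by (intro antisym sum_nonneg) auto
      then have "d x i = 0" for i
        using sum_nonneg_eq_0_iff[of "{..n}" "\<lambda>i. (d x i)\<^sup>2"] by (cases "i \<le> n") (auto simp: d_def)
      \<comment> \<open>Writing zero as a multiple by 0 lets the scaling rule yield
        \<open>g (d x) = 0\<close>, that is \<open>x = 0\<close>.\<close>
      then have "d x = (\<lambda>i. 0 * d x i)" by auto
      then have "g (d x) v = 0" for v using g_scale[of 0 "d x" v] by simp
      then have "x v = 0" for v using g_d[of x v] x mem_K by metis
      then show False using x mem_K[of x] by simp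
    qed
    have "homeomorphic_maps (realization K) (nsphere n) F G"
      unfolding homeomorphic_maps_def
    proof (intro conjI ballI)
      let ?X = "realization K" and ?Y = "nsphere n"
      have coord: "continuous_map ?X euclideanreal (\<lambda>x. x v)" for v
        by (rule continuous_map_realization_coordinate)
      have d_cont: "continuous_map ?X euclideanreal (\<lambda>x. d x i)" for i
        unfolding d_def using coord by (auto intro!: continuous_intros)
      have "(\<Sum>i\<le>n. (F x i)\<^sup>2) = 1" if "x \<in> topspace ?X" for x
      proof -
        have "(\<Sum>i\<le>n. (F x i)\<^sup>2) = (\<Sum>i\<le>n. (d x i)\<^sup>2) / (sqrt (\<Sum>i\<le>n. (d x i)\<^sup>2))\<^sup>2"
          unfolding F_def by (simp only: power_divide sum_divide_distrib)
        also have "\<dots> = 1" using norm_pos[OF that] by (simp add: sum_nonneg)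
        finally show ?thesis .
      qed
      then have "F \<in> topspace ?X \<rightarrow> topspace ?Y"
        by (auto simp: sphere) (simp add: F_def d_def)
      moreover have "continuous_map ?X euclideanreal (\<lambda>x. F x i)" for i
        unfolding F_def using norm_pos[THEN less_imp_neq, symmetric]
        by (intro continuous_map_real_divide continuous_map_sqrt continuous_map_sum
              continuous_map_real_pow d_cont) auto
      ultimately show "continuous_map ?X ?Y F"
        unfolding nsphere by (auto simp: continuous_map_in_subtopology continuous_map_componentwise_UNIV)
      have y_cont: "continuous_map ?Y euclideanreal (\<lambda>z. y z v)" for v
        unfolding y_def using continuous_map_nsphere_projection by auto
      have "continuous_map ?Y euclideanreal (\<lambda>z. \<mu> z N)" if "N \<in> \<N>" for N
        unfolding \<mu>_def using fin(2,3)[OF that] y_cont by (intro continuous_map_Min) auto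
      then have g_cont: "continuous_map ?Y euclideanreal (\<lambda>z. g z v)" for v
        unfolding g_def using y_cont block by (cases "v \<in> V") (auto intro!: continuous_intros)
      have "G z \<in> topspace ?X" if z: "z \<in> topspace ?Y" for z
        unfolding mem_K
      proof (intro conjI allI ballI impI)
        show "0 \<le> G z v" for v using g_nonneg g_pos[OF z] by (simp add: G_def)
        show "G z v = 0" if "v \<notin> V" for v using that by (simp add: G_def g_def)
        show "sum (G z) V = 1" using g_pos[OF z] by (simp add: G_def flip: sum_divide_distrib)
        fix N assume N: "N \<in> \<N>"
        then obtain v where v: "v \<in> N" "y z v = \<mu> z N" using \<mu>_ex by blast
        then have "G z v = 0" using block_eq[OF N v(1)] by (simp add: G_def g_def)
        then show "\<exists>v\<in>N. G z v = 0" using v by blast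
      qed
      moreover have "continuous_map ?Y euclideanreal (\<lambda>z. G z v)" for v
        unfolding G_def using g_pos finV
        by (intro continuous_map_real_divide continuous_map_sum g_cont) force+
      ultimately show "continuous_map ?Y ?X G"
        by (auto simp: continuous_map_into_realization)
      show "G (F x) = x" if x: "x \<in> topspace ?X" for x
      proof -
        let ?c = "1 / sqrt (\<Sum>i\<le>n. (d x i)\<^sup>2)"
        have c: "0 < ?c" using norm_pos[OF x] by simp
        have "F x = (\<lambda>i. ?c * d x i)" by (simp add: F_def)
        moreover have "g (d x) v = x v" for v using g_d[of x v] x mem_K[of x] by blast
        moreover have "0 \<le> ?c" using c by simp
        ultimately have g_F: "g (F x) = (\<lambda>v. ?c * x v)"
          using g_scale[of ?c "d x"] by presburger
        have "sum (g (F x)) V = ?c"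
          using x mem_K[of x] by (simp only: g_F flip: sum_distrib_left)
        then show ?thesis unfolding G_def using g_F c by (simp add: fun_eq_iff)
      qed
      show "F (G z) = z" if z: "z \<in> topspace ?Y" for z
      proof -
        let ?c = "1 / sum (g z) V"
        have c: "0 < ?c" using g_pos[OF z] by simp
        have "G z = (\<lambda>v. ?c * g z v)" by (simp add: G_def)
        moreover have "d (g z) i = z i" for i using d_g[of z i] z sphere[of z] by blast
        ultimately have d_G: "d (G z) = (\<lambda>i. ?c * z i)"
          using d_scale[of ?c "g z"] by presburger
        have "(\<Sum>i\<le>n. (d (G z) i)\<^sup>2) = ?c\<^sup>2 * (\<Sum>i\<le>n. (z i)\<^sup>2)"
          unfolding d_G by (simp only: power_mult_distrib sum_distrib_left)
        then have "sqrt (\<Sum>i\<le>n. (d (G z) i)\<^sup>2) = ?c" using z sphere[of z] c by simp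
        then show ?thesis unfolding F_def using d_G c by (simp add: fun_eq_iff)
      qed
    qed
    then show ?thesis
      unfolding homeomorphic_to_sphere_def K_def homeomorphic_space_def by blast
  qed
qed

section \<open>The Stanley-Reisner description of the external activity complex\<close>

locale ordered_matroid = matroid M for M :: "'a indep_system" +
  fixes r :: "'a rel"
  assumes linear_order: "linear_order_on (ground M) r"
begin

text \<open>This is the position in the linear order, not the matroid rank. It turns comparisons in
  \<open>r\<close> into arithmetic on natural numbers.\<close>

definition rank_in :: "'a \<Rightarrow> nat" where
  "rank_in x = card {y \<in> ground M. (y, x) \<in> r}"

lemma order_iff_rank_in:
  assumes "x \<in> ground M" "y \<in> ground M"
  shows "(x, y) \<in> r \<longleftrightarrow> rank_in x \<le> rank_in y"
proof -
  have r: "refl_on (ground M) r" "trans r" "antisym r" "total_on (ground M) r"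
    using linear_order by (auto simp: order_on_defs)
  have le: "rank_in x \<le> rank_in y" if "(x, y) \<in> r" for x y
    unfolding rank_in_def using finite_ground that r(2)
    by (intro card_mono) (auto dest: transD)
  have "rank_in y < rank_in x" if "(x, y) \<notin> r"
  proof -
    have "(y, x) \<in> r" using r(1,4) assms that by (metis refl_onD total_on_def)
    moreover have "x \<in> {z \<in> ground M. (z, x) \<in> r}" "x \<notin> {z \<in> ground M. (z, y) \<in> r}"
      using assms that r(1) by (auto simp: refl_on_def)
    ultimately have "{z \<in> ground M. (z, y) \<in> r} \<subset> {z \<in> ground M. (z, x) \<in> r}"
      using r(2) by (blast dest: transD)
    then show ?thesis unfolding rank_in_def using finite_ground by (intro psubset_card_mono) auto
  qed
  then show ?thesis using le by (meson not_le)
qed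

lemma rank_in_inj:
  assumes "x \<in> ground M" "y \<in> ground M" "rank_in x = rank_in y"
  shows "x = y"
proof -
  have "(x, y) \<in> r" "(y, x) \<in> r" using order_iff_rank_in assms by auto
  moreover have "antisym r" using linear_order by (simp add: order_on_defs)
  ultimately show ?thesis by (rule antisymD[rotated])
qed

definition is_min :: "'a \<Rightarrow> 'a set \<Rightarrow> bool" where
  "is_min c C \<longleftrightarrow> c \<in> C \<and> (\<forall>x\<in>C. rank_in c \<le> rank_in x)"

lemma circuit_min:
  assumes "is_circuit M C"
  obtains c where "is_min c C"
proof -
  obtain c where "is_arg_min rank_in (\<lambda>x. x \<in> C) c"
    using ex_is_arg_min_if_finite[OF finite_circuit circuit_nonempty] assms by blast
  then show thesis using that by (auto simp: is_arg_min_linorder is_min_def)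
qed

lemma is_min_unique: "is_circuit M C \<Longrightarrow> is_min c C \<Longrightarrow> is_min d C \<Longrightarrow> c = d"
  using circuit_subset_ground rank_in_inj unfolding is_min_def by (meson le_antisym subsetD)

lemma ext_active_iff:
  assumes "is_basis M B"
  shows "e \<in> ext_active M r B \<longleftrightarrow> e \<in> ground M - B \<and> is_min e (fund_circuit M B e)"
proof (cases "e \<in> ground M - B")
  case True
  then obtain C where C: "is_circuit M C" "fund_circuit M B e = C"
    using basis_circuit[OF assms] by (metis DiffD1 DiffD2)
  have "\<forall>x\<in>C. (e, x) \<in> r \<longleftrightarrow> rank_in e \<le> rank_in x"
    using order_iff_rank_in True circuit_subset_ground[OF C(1)] by blast
  then show ?thesis using True by (auto simp: ext_active_def is_min_def C(2))
qed (auto simp: ext_active_def)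

text \<open>The \<open>Inr\<close> part is a copy of the broken circuit of \<open>C\<close> in the
  usual sense. For a circuit the \<open>Inl\<close> part is a single vertex.\<close>

definition broken :: "'a set \<Rightarrow> ('a + 'a) set" where
  "broken C = Inl ` {c. is_min c C} \<union> Inr ` {x \<in> C. \<not> is_min x C}"

lemma Inl_broken [simp]: "Inl c \<in> broken C \<longleftrightarrow> is_min c C"
  by (auto simp: broken_def)

lemma Inr_broken [simp]: "Inr x \<in> broken C \<longleftrightarrow> x \<in> C \<and> \<not> is_min x C"
  by (auto simp: broken_def)

lemma broken_subset_iff:
  assumes "is_circuit M C" "is_min c C"
  shows "broken C \<subseteq> F \<longleftrightarrow> Inl c \<in> F \<and> (\<forall>x\<in>C. x \<noteq> c \<longrightarrow> Inr x \<in> F)"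
proof -
  have *: "is_min x C \<longleftrightarrow> x = c" for x using is_min_unique[OF assms(1)] assms(2) by blast
  show ?thesis unfolding broken_def * using assms(2) by (auto simp: is_min_def)
qed

lemma finite_broken: "is_circuit M C \<Longrightarrow> finite (broken C)"
  using finite_circuit[of C] finite_subset[of "{c. is_min c C}" C] by (auto simp: broken_def is_min_def)

lemma broken_nonempty: "is_circuit M C \<Longrightarrow> broken C \<noteq> {}"
  using circuit_min Inl_broken by (metis empty_iff)

text \<open>Forgetting the copy recovers the circuit, and circuits form an antichain. This makes
  every \<open>broken C\<close> a minimal nonface.\<close>

lemma broken_subset_imp_eq:
  assumes "is_circuit M C" "is_circuit M D" "broken C \<subseteq> broken D"
  shows "C = D"
proof -
  have "x \<in> D" if "x \<in> C" for x
    using that assms(3) Inl_broken[of x C] Inr_broken[of x C] Inl_broken[of x D] Inr_broken[of x D]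
    unfolding is_min_def by blast
  then show ?thesis using circuit_subset_eq assms by blast
qed

text \<open>Eliminating an active element of \<open>C\<close> keeps the minimum of \<open>C\<close>, because the elements
  brought in by a fundamental circuit are larger than the active element. Eventually \<open>C\<close> becomes
  a fundamental circuit with minimum outside \<open>B\<close>.\<close>

lemma broken_not_subset_facet:
  assumes B: "is_basis M B" and "is_circuit M C"
  shows "\<not> broken C \<subseteq> act_facet M r B"
  using assms(2)
proof (induction "card (C - B)" arbitrary: C rule: less_induct)
  case less
  have Bi: "B \<in> indeps M" using B by (simp add: is_basis_def)
  obtain c where c: "is_min c C" using circuit_min less.prems by blast
  have cC: "c \<in> C" using c by (simp add: is_min_def)
  show ?case
  proof
    assume "broken C \<subseteq> act_facet M r B"
    then have cF: "Inl c \<in> act_facet M r B" and rest: "\<And>x. x \<in> C \<Longrightarrow> x \<noteq> c \<Longrightarrow> Inr x \<in> act_facet M r B"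
      using broken_subset_iff[OF less.prems c] by auto
    \<comment> \<open>The plain copy of \<open>c\<close> lies in the facet only if \<open>c\<close>
      is in \<open>B\<close> or externally passive.\<close>
    have c': "c \<notin> ext_active M r B" using cF by (auto simp: act_facet_def ext_passive_def ext_active_def)
    have rest': "x \<in> B \<or> x \<in> ext_active M r B" if "x \<in> C" "x \<noteq> c" for x
      using rest[OF that] by (auto simp: act_facet_def)
    show False
    proof (cases "C \<subseteq> insert c B")
      case True
      have "c \<notin> B" using circuit_not_subset_indep[OF less.prems Bi] True by blast
      moreover have "fund_circuit M B c = C" by (rule fund_circuit_eq[OF Bi less.prems True])
      ultimately have "c \<in> ext_active M r B"
        using ext_active_iff[OF B] c cC circuit_subset_ground[OF less.prems] by auto
      then show False using c' by blast
    next
      case False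
      then obtain x where x: "x \<in> C" "x \<noteq> c" "x \<notin> B" by blast
      then have "x \<in> ext_active M r B" using rest' by blast
      then have xmin: "x \<in> ground M" "is_min x (fund_circuit M B x)" using ext_active_iff[OF B] by auto
      then obtain D where D: "is_circuit M D" "D \<subseteq> insert x B" "x \<in> D" "is_min x D"
        using basis_circuit[OF B xmin(1) x(3)] by metis
      have lt: "rank_in c < rank_in y" if "y \<in> C \<union> D" "y \<noteq> c" for y
      proof -
        have "rank_in c \<le> rank_in x" using c x(1) by (simp add: is_min_def)
        then have "rank_in c \<le> rank_in y" using that(1) c D(4) unfolding is_min_def by force
        moreover have "rank_in c \<noteq> rank_in y"
          using rank_in_inj[of c y] that cC circuit_subset_ground[OF less.prems] circuit_subset_ground[OF D(1)]
          by blast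
        ultimately show ?thesis by simp
      qed
      have "c \<notin> D"
      proof
        assume "c \<in> D"
        then have "rank_in x \<le> rank_in c" using D(4) by (simp add: is_min_def)
        then show False using lt[of x] x by simp
      qed
      then obtain A where A: "is_circuit M A" "c \<in> A" "A \<subseteq> C \<union> D - {x}"
        using strong_circuit_elimination[OF less.prems D(1) x(1) D(3) cC] by blast
      have "is_min c A" unfolding is_min_def using A lt by (metis DiffD1 less_imp_le order_refl subsetD)
      moreover have "Inr y \<in> act_facet M r B" if "y \<in> A" "y \<noteq> c" for y
      proof (cases "y \<in> B")
        case True
        then show ?thesis by (simp add: act_facet_def)
      next
        case False
        then have "y \<in> C" using that(1) A(3) D(2) by blast
        then show ?thesis using rest that(2) by blast
      qed
      ultimately have "broken A \<subseteq> act_facet M r B" using broken_subset_iff[OF A(1)] cF by blast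
      \<comment> \<open>The element \<open>x\<close> has left, and \<open>D\<close> contributes only
        elements of \<open>B\<close> besides it.\<close>
      moreover have "A - B \<subset> C - B" using A(3) D(2) x by blast
      then have "card (A - B) < card (C - B)"
        using finite_circuit[OF less.prems] by (intro psubset_card_mono) auto
      ultimately show False using less.hyps A(1) by blast
    qed
  qed
qed

text \<open>A face avoiding all \<open>broken C\<close> lies in the facet of the greedy basis for the order that
  lists the elements \<open>y\<close> with \<open>Inr y \<in> F\<close> first, in decreasing order, and then the others in
  increasing order.\<close>

lemma face_in_facet:
  assumes F: "F \<subseteq> Inl ` ground M \<union> Inr ` ground M"
    and avoid: "\<And>C. is_circuit M C \<Longrightarrow> \<not> broken C \<subseteq> F"
  obtains B where "is_basis M B" "F \<subseteq> act_facet M r B"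
proof -
  \<comment> \<open>The shift by one makes the first kind of key negative, while the second kind is
    nonnegative, so the two groups never interleave.\<close>
  define key where "key x = (if Inr x \<in> F then - int (rank_in x) - 1 else int (rank_in x))" for x
  obtain B where B: "is_basis M B" and greedy: "\<And>x. x \<in> ground M \<Longrightarrow> x \<notin> B \<Longrightarrow>
      \<exists>C. is_circuit M C \<and> x \<in> C \<and> C \<subseteq> insert x B \<and> (\<forall>z\<in>C. key z \<le> key x)"
    using greedy_basis[of key] by blast
  have Bi: "B \<in> indeps M" using B by (simp add: is_basis_def)
  have fund: "x \<in> fund_circuit M B x \<and> is_circuit M (fund_circuit M B x) \<and>
      (\<forall>z\<in>fund_circuit M B x. key z \<le> key x)" if "x \<in> ground M" "x \<notin> B" for x
    using greedy[OF that] fund_circuit_eq[OF Bi] by metis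
  have "Inl x \<in> act_facet M r B" if x: "Inl x \<in> F" for x
  proof (rule ccontr)
    have xE: "x \<in> ground M" using F x by blast
    assume "Inl x \<notin> act_facet M r B"
    then have xB: "x \<notin> B" and "x \<in> ext_active M r B"
      using xE by (auto simp: act_facet_def ext_passive_def)
    then have min: "is_min x (fund_circuit M B x)" using ext_active_iff[OF B] by blast
    have C: "is_circuit M (fund_circuit M B x)" using fund[OF xE xB] by blast
    \<comment> \<open>Otherwise \<open>z\<close> has a nonnegative key, hence so has
      \<open>x\<close>, and the greedy choice puts \<open>z\<close> no later than \<open>x\<close>
      in the order, against the minimality of \<open>x\<close>.\<close>
    have "Inr z \<in> F" if z: "z \<in> fund_circuit M B x" "z \<noteq> x" for z
    proof (rule ccontr)
      assume "Inr z \<notin> F"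
      then have "int (rank_in z) \<le> key x" using fund[OF xE xB] z(1) by (auto simp: key_def)
      then have "rank_in z \<le> rank_in x" by (auto simp: key_def split: if_splits)
      then have "rank_in z = rank_in x" using min z(1) by (simp add: is_min_def le_antisym)
      then show False using rank_in_inj[of z x] xE z circuit_subset_ground[OF C] by blast
    qed
    then have "broken (fund_circuit M B x) \<subseteq> F" using broken_subset_iff[OF C min] x by blast
    then show False using avoid[OF C] by blast
  qed
  moreover have "Inr y \<in> act_facet M r B" if y: "Inr y \<in> F" for y
  proof (cases "y \<in> B")
    case False
    have yE: "y \<in> ground M" using F y by blast
    \<comment> \<open>The key of \<open>y\<close> is negative, so every \<open>z\<close> on the
      circuit has a negative key too, and among those the comparison of ranks is reversed.\<close>
    have "rank_in y \<le> rank_in z" if "z \<in> fund_circuit M B y" for z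
    proof -
      have "key z \<le> - int (rank_in y) - 1" using fund[OF yE False] that y by (simp add: key_def)
      then show ?thesis by (auto simp: key_def split: if_splits)
    qed
    then have "y \<in> ext_active M r B"
      using ext_active_iff[OF B] fund[OF yE False] yE False by (simp add: is_min_def)
    then show ?thesis by (simp add: act_facet_def)
  qed (simp add: act_facet_def)
  ultimately have "F \<subseteq> act_facet M r B" using F by blast
  with B that show thesis by blast
qed

section \<open>Nonfaces and cone points of the complex\<close>

lemma act_facet_subset: "is_basis M B \<Longrightarrow> act_facet M r B \<subseteq> Inl ` ground M \<union> Inr ` ground M"
  using indeps_subset_ground[of B]
  by (auto simp: act_facet_def ext_passive_def ext_active_def is_basis_def)

lemma Act_eq:
  "Act M r = {F. F \<subseteq> Inl ` ground M \<union> Inr ` ground M \<and> (\<forall>C. is_circuit M C \<longrightarrow> \<not> broken C \<subseteq> F)}"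
proof (intro set_eqI iffI)
  fix F assume "F \<in> Act M r"
  then obtain B where "is_basis M B" "F \<subseteq> act_facet M r B" by (auto simp: Act_def)
  then show "F \<in> {F. F \<subseteq> Inl ` ground M \<union> Inr ` ground M \<and> (\<forall>C. is_circuit M C \<longrightarrow> \<not> broken C \<subseteq> F)}"
    using act_facet_subset broken_not_subset_facet by blast
next
  fix F assume "F \<in> {F. F \<subseteq> Inl ` ground M \<union> Inr ` ground M \<and> (\<forall>C. is_circuit M C \<longrightarrow> \<not> broken C \<subseteq> F)}"
  then obtain B where "is_basis M B" "F \<subseteq> act_facet M r B"
    using face_in_facet[of F] by auto
  then show "F \<in> Act M r" by (auto simp: Act_def)
qed

abbreviation circuits :: "'a set set" where
  "circuits \<equiv> {C. is_circuit M C}"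

lemma broken_subset_ground: "is_circuit M C \<Longrightarrow> broken C \<subseteq> Inl ` ground M \<union> Inr ` ground M"
  using circuit_subset_ground[of C] by (auto simp: broken_def is_min_def)

text \<open>A vertex outside all \<open>broken C\<close> can be added to any face, so every facet
  has it. A vertex \<open>v\<close> of some \<open>broken C\<close> is missing from any facet above
  the face \<open>broken C - {v}\<close>; finiteness provides such a facet.\<close>

lemma cone_points_Act: "cone_points (Act M r) = Inl ` ground M \<union> Inr ` ground M - \<Union>(broken ` circuits)"
proof (intro set_eqI iffI)
  let ?V = "Inl ` ground M \<union> Inr ` ground M"
  have fin: "finite (Act M r)"
    by (rule finite_subset[of _ "Pow ?V"]) (use Act_eq finite_ground in auto)
  have in_facet: "\<exists>G\<in>facets (Act M r). F \<subseteq> G" if F: "F \<in> Act M r" for F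
  proof -
    obtain G where "G \<in> Act M r" "F \<subseteq> G" "\<forall>H\<in>Act M r. G \<subseteq> H \<longrightarrow> G = H"
      using finite_has_maximal2[OF fin F] by meson
    then show ?thesis unfolding facets_def by (intro bexI[of _ G]) auto
  qed
  fix v
  {
    assume v: "v \<in> cone_points (Act M r)"
    have insert_face: "insert v F \<in> Act M r" if F: "F \<in> Act M r" for F
    proof -
      obtain G where G: "G \<in> facets (Act M r)" "F \<subseteq> G" using in_facet[OF F] by blast
      then have "insert v F \<subseteq> G" "G \<in> Act M r" using v by (auto simp: cone_points_def facets_def)
      then show ?thesis unfolding Act_def by blast
    qed
    \<comment> \<open>A cone point could a priori be any element of the sum type; adding it to the
      empty face shows that it comes from the ground set.\<close>
    have "{} \<in> Act M r" unfolding Act_eq using broken_nonempty by blast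
    then have "v \<in> ?V" using insert_face unfolding Act_eq by blast
    moreover have "v \<notin> broken C" if C: "is_circuit M C" for C
    proof
      assume vC: "v \<in> broken C"
      have "broken C - {v} \<in> Act M r"
        unfolding Act_eq using broken_subset_ground[OF C] broken_subset_imp_eq[OF _ C] vC by blast
      then have "broken C \<in> Act M r" using insert_face vC by (metis insert_Diff)
      then show False using C unfolding Act_eq by blast
    qed
    ultimately show "v \<in> ?V - \<Union>(broken ` circuits)" by blast
  next
    assume v: "v \<in> ?V - \<Union>(broken ` circuits)"
    have "v \<in> F" if F: "F \<in> facets (Act M r)" for F
    proof -
      have "F \<in> Act M r" using F by (simp add: facets_def)
      then have "insert v F \<in> Act M r" using v unfolding Act_eq by (auto simp: subset_insert)
      then show ?thesis using F unfolding facets_def by blast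
    qed
    then show "v \<in> cone_points (Act M r)" by (simp add: cone_points_def)
  }
qed

lemma reduced_Act_eq:
  "reduced_Act M r = {F. F \<subseteq> \<Union>(broken ` circuits) \<and> (\<forall>N\<in>broken ` circuits. \<not> N \<subseteq> F)}"
  unfolding reduced_Act_def delete_vertices_def cone_points_Act unfolding Act_eq
  using broken_subset_ground by blast

section \<open>Contractibility\<close>

text \<open>If no element were both minimal and non-minimal, then circuits with a common minimum would
  coincide, as eliminating it leaves a circuit without a minimum; but strong elimination
  preserves the minimum of one of two intersecting circuits.\<close>

lemma min_and_nonmin:
  assumes C: "is_circuit M C" and D: "is_circuit M D" and "C \<noteq> D" "C \<inter> D \<noteq> {}"
  obtains e A A' where "is_circuit M A" "is_min e A" "is_circuit M A'" "e \<in> A'" "\<not> is_min e A'"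
proof (rule ccontr)
  assume "\<not> thesis"
  with that have *: "is_min e A'" if "is_circuit M A" "is_min e A" "is_circuit M A'" "e \<in> A'" for e A A'
    using that by blast
  have same: "A = A'" if A: "is_circuit M A" "is_circuit M A'" "is_min c A" "is_min c A'" for A A' c
  proof (rule ccontr)
    assume "A \<noteq> A'"
    moreover have "c \<in> A" "c \<in> A'" using A by (auto simp: is_min_def)
    ultimately obtain A'' where A'': "is_circuit M A''" "A'' \<subseteq> A \<union> A' - {c}"
      using circuit_elimination[OF A(1,2)] by blast
    obtain d where d: "is_min d A''" using circuit_min A''(1) by blast
    then have "d \<in> A \<union> A' - {c}" using A''(2) by (auto simp: is_min_def)
    then have "is_min d A \<or> is_min d A'" "d \<noteq> c" using *[OF A''(1) d] A by auto
    then show False using is_min_unique A by blast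
  qed
  obtain e where e: "e \<in> C" "e \<in> D" using assms(4) by blast
  obtain c d where c: "is_min c C" "is_min d D" using circuit_min C D by metis
  have "c \<notin> D" using *[OF C c(1) D] same[OF C D c(1)] assms(3) by blast
  moreover have "c \<in> C" using c by (simp add: is_min_def)
  ultimately obtain A where A: "is_circuit M A" "c \<in> A" "A \<subseteq> C \<union> D - {e}"
    using strong_circuit_elimination[OF C D e] by blast
  \<comment> \<open>By \<open>*\<close> the element \<open>c\<close> is also the minimum of
    \<open>A\<close>, which forces \<open>A = C\<close>, although \<open>e\<close> lies in
    \<open>C\<close> and not in \<open>A\<close>.\<close>
  then have "A = C" using *[OF C c(1)] same C c(1) by blast
  then show False using A(3) e by blast
qed

text \<open>For a circuit \<open>D\<close> with non-minimal element \<open>e\<close> the link of \<open>broken D - {Inr e}\<close> is a cone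
  with apex \<open>Inl e\<close>, by strong elimination of \<open>e\<close> from \<open>D\<close> and a circuit with minimum \<open>e\<close>.\<close>

lemma contractible_reduced_Act:
  assumes A: "is_circuit M A" "is_min e A" and A': "is_circuit M A'" "e \<in> A'" "\<not> is_min e A'"
  shows "topspace (realization (reduced_Act M r)) \<noteq> {}"
    and "contractible_space (realization (reduced_Act M r))"
proof -
  let ?V = "\<Union>(broken ` circuits)"
  let ?K = "reduced_Act M r"
  have eV: "Inl e \<in> ?V" "Inr e \<in> ?V" using A A' by (auto intro: exI[of _ A] exI[of _ A'])
  have face: "F \<in> ?K \<longleftrightarrow> F \<subseteq> ?V \<and> (\<forall>C. is_circuit M C \<longrightarrow> \<not> broken C \<subseteq> F)" for F
    unfolding reduced_Act_eq by auto
  \<comment> \<open>Every \<open>broken C\<close> contains a vertex of the plain copy, so none fits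
    into \<open>{Inr e}\<close>.\<close>
  have "{Inr e} \<in> ?K"
    unfolding face using eV(2) circuit_min Inl_broken
    by (metis Inl_Inr_False empty_subsetI insert_subset singletonD subsetD)
  moreover have "{v. (if v = Inr e then 1 else (0::real)) \<noteq> 0} = {Inr e}" by auto
  ultimately have "(\<lambda>v. if v = Inr e then 1 else 0) \<in> topspace (realization ?K)"
    by (simp add: topspace_realization)
  then show "topspace (realization ?K) \<noteq> {}" by blast

  define \<D> where "\<D> = {D. is_circuit M D \<and> e \<in> D \<and> \<not> is_min e D}"
  have fin: "finite ?V" using circuits_finite finite_broken by auto
  have sub: "?K \<subseteq> Pow ?V" using face by blast
  have down: "G \<in> ?K" if "F \<in> ?K" "G \<subseteq> F" for F G using that unfolding face by blast
  show "contractible_space (realization ?K)"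
  proof (rule contractible_remove_faces[where \<R> = "(\<lambda>D. broken D - {Inr e}) ` \<D>" and w = "Inl e"])
    show "finite ((\<lambda>D. broken D - {Inr e}) ` \<D>)"
      using circuits_finite by (auto simp: \<D>_def)
    show "finite R \<and> R \<noteq> {} \<and> Inl e \<notin> R" if R: "R \<in> (\<lambda>D. broken D - {Inr e}) ` \<D>" for R
    proof -
      obtain D where D: "is_circuit M D" "\<not> is_min e D" "R = broken D - {Inr e}"
        using R by (auto simp: \<D>_def)
      obtain d where "is_min d D" using circuit_min D(1) by blast
      then have "Inl d \<in> R" using D(3) by simp
      moreover have "finite R" "Inl e \<notin> R" using D finite_broken[OF D(1)] by auto
      ultimately show ?thesis by blast
    qed
    show "insert (Inl e) F \<in> ?K"
      if R: "R \<in> (\<lambda>D. broken D - {Inr e}) ` \<D>" and F: "F \<in> ?K" "R \<subseteq> F" for R F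
    proof -
      obtain D where D: "is_circuit M D" "e \<in> D" "\<not> is_min e D" "R = broken D - {Inr e}"
        using R by (auto simp: \<D>_def)
      obtain d where d: "is_min d D" using circuit_min D(1) by blast
      have dD: "d \<in> D" "d \<noteq> e" "rank_in d \<le> rank_in e" using d D(2,3) by (auto simp: is_min_def)
      have "\<not> broken C \<subseteq> insert (Inl e) F" if C: "is_circuit M C" for C
      proof
        assume CF: "broken C \<subseteq> insert (Inl e) F"
        have "\<not> broken C \<subseteq> F" using F(1) C face by blast
        then have e: "is_min e C" using CF Inl_broken by blast
        then have eC: "e \<in> C" by (simp add: is_min_def)
        have lt: "rank_in d < rank_in e"
          using rank_in_inj[of d e] dD D(2) circuit_subset_ground[OF D(1)] by fastforce
        then have "d \<notin> C" using e unfolding is_min_def by (meson not_le)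
        \<comment> \<open>The elements of \<open>C\<close> are not below \<open>e\<close>, which is
          above \<open>d\<close>, so \<open>d\<close> is the minimum of \<open>S\<close>. All
          vertices of \<open>broken S\<close> then come from \<open>R\<close> or from the
          \<open>Inr\<close> part of \<open>broken C\<close>, so \<open>broken S\<close> lies in
          \<open>F\<close> already, without \<open>Inl e\<close>.\<close>
        then obtain S where S: "is_circuit M S" "d \<in> S" "S \<subseteq> D \<union> C - {e}"
          using strong_circuit_elimination[OF D(1) C D(2) eC dD(1)] by blast
        have "rank_in d \<le> rank_in x" if "x \<in> S" for x
          using that S(3) d e lt unfolding is_min_def by fastforce
        then have "is_min d S" using S(2) by (simp add: is_min_def)
        moreover have "Inl d \<in> F" using F(2) D(4) d by auto
        moreover have "Inr x \<in> F" if "x \<in> S" "x \<noteq> d" for x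
        proof (cases "x \<in> D")
          case True
          then have "Inr x \<in> R" using D(4) that S(3) is_min_unique[OF D(1) d] by auto
          then show ?thesis using F(2) by blast
        next
          case False
          then have "x \<in> C" "x \<noteq> e" using that S(3) by auto
          then have "Inr x \<in> broken C" using is_min_unique[OF C e] by auto
          then show ?thesis using CF by blast
        qed
        ultimately have "broken S \<subseteq> F" using broken_subset_iff[OF S(1)] by blast
        then show False using F(1) S(1) face by blast
      qed
      then show ?thesis using F(1) eV(1) unfolding face by blast
    qed
    let ?L = "{F \<in> ?K. \<forall>R\<in>(\<lambda>D. broken D - {Inr e}) ` \<D>. \<not> R \<subseteq> F}"
    show "contractible_space (realization ?L)"
    proof (rule contractible_cone[OF fin, where w = "Inr e"])
      show "?L \<subseteq> Pow ?V" using sub by blast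
      show "G \<in> ?L" if "F \<in> ?L" "G \<subseteq> F" for F G using that down[of F G] by blast
      show "insert (Inr e) F \<in> ?L" if F: "F \<in> ?L" for F
      proof -
        have FK: "F \<in> ?K" using F by blast
        have no: "\<not> broken D - {Inr e} \<subseteq> F" if "D \<in> \<D>" for D using F that by blast
        \<comment> \<open>Adding \<open>Inr e\<close> could only complete a \<open>broken C\<close>
          that contains it. Then \<open>C\<close> belongs to \<D>, and the rest of
          \<open>broken C\<close> is one of the removed sets.\<close>
        have "\<not> broken C \<subseteq> insert (Inr e) F" if C: "is_circuit M C" for C
        proof (cases "C \<in> \<D>")
          case True
          then show ?thesis using no by blast
        next
          case False
          then have "Inr e \<notin> broken C" using C by (simp add: \<D>_def)
          then show ?thesis using FK C face by (simp add: subset_insert)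
        qed
        then have "insert (Inr e) F \<in> ?K" using FK eV(2) unfolding face by blast
        moreover have "\<not> broken D - {Inr e} \<subseteq> insert (Inr e) F" if "D \<in> \<D>" for D
          using no[OF that] by blast
        ultimately show ?thesis by blast
      qed
    qed
  qed (use fin sub down in blast)+
qed

end

theorem theorem1p4:
  fixes M :: "'a indep_system" and r :: "'a rel"
  assumes "matroid M" and "linear_order_on (ground M) r"
  shows "(has_minor M U31 \<longrightarrow>
            topspace (realization (reduced_Act M r)) \<noteq> {} \<and>
            contractible_space (realization (reduced_Act M r))) \<and>
         (\<not> has_minor M U31 \<longrightarrow>
            homeomorphic_to_sphere (realization (reduced_Act M r)))"
proof -
  interpret ordered_matroid M r
    using assms by (simp add: ordered_matroid_def ordered_matroid_axioms_def)
  have "topspace (realization (reduced_Act M r)) \<noteq> {} \<and>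
      contractible_space (realization (reduced_Act M r))" if minor: "has_minor M U31"
  proof -
    obtain C D where "is_circuit M C" "is_circuit M D" "C \<noteq> D" "C \<inter> D \<noteq> {}"
      using has_minor_U31_imp_circuits[OF minor] .
    then obtain e A A' where "is_circuit M A" "is_min e A" "is_circuit M A'" "e \<in> A'" "\<not> is_min e A'"
      by (rule min_and_nonmin)
    then show ?thesis using contractible_reduced_Act by blast
  qed
  moreover have "homeomorphic_to_sphere (realization (reduced_Act M r))" if "\<not> has_minor M U31"
    unfolding reduced_Act_eq
  proof (rule join_of_simplex_boundaries_sphere)
    show "finite (broken ` circuits)" using circuits_finite by blast
    show "finite N" "N \<noteq> {}" if "N \<in> broken ` circuits" for N
      using that finite_broken broken_nonempty by auto
    show "N \<inter> N' = {}" if N: "N \<in> broken ` circuits" "N' \<in> broken ` circuits" "N \<noteq> N'" for N N'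
    proof -
      obtain C C' where C: "is_circuit M C" "is_circuit M C'" "N = broken C" "N' = broken C'"
        using N by blast
      then have "C \<inter> C' = {}"
        using circuits_imp_has_minor_U31[of C C'] \<open>\<not> has_minor M U31\<close> N(3) by blast
      then show ?thesis using C by (auto simp: broken_def is_min_def)
    qed
  qed
  ultimately show ?thesis by blast
qed

end
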